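(* Let $n\geq 2$ and $a_n\in\mathbb{F}_q^\times$. For every $t\in T_n$, $$f_{T_n}\big(e_{\psi_n}\,g_{n-1,1}(1,a_n)\,e_{\psi_n}\big)(t)=\begin{cases}\dfrac{1}{q^{n-1}}\,\psi(\mathrm{Tr}(t^{-1})), & \det(t)=(-1)^{n-1}a_n,\\[2mm] 0, & \text{otherwise.}\end{cases}$$ Explicitly, the elements $t\in T_n$ with $\det(t)=(-1)^{n-1}a_n$ can be parameterized by $y_{1,1},\dots,y_{n-1,n-1}\in\mathbb{F}_q^\times$ as $$t=\mathrm{diag}\Big\{y_{1,1},-\frac{y_{2,2}}{y_{1,1}},-\frac{y_{3,3}}{y_{2,2}},\dots,-\frac{y_{n-1,n-1}}{y_{n-2,n-2}},-\frac{a_n}{y_{n-1,n-1}}\Big\},$$ and then $$\psi(\mathrm{Tr}(t^{-1}))=\psi\Big(\frac{1}{y_{1,1}}-\sum_{j=2}^{n-1}\frac{y_{j-1,j-1}}{y_{j,j}}-\frac{y_{n-1,n-1}}{a_n}\Big).$$ The argument of $\psi$ is the sum over the arrows of the Gelfand-Tsetlin diagram with horizontal arrows $y_{1,1}\to y_{2,2}\to\cdots\to y_{n-1,n-1}\to a_n$ and one vertical arrow $1\to y_{1,1}$, where a vertical arrow $x\to y$ contributes $+x/y$ and a horizontal arrow $x\to y$ contributes $-x/y$.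
   Context: Let $\mathbb{F}_q$ be a finite field, $q$ a power of an odd prime, $\psi:\mathbb{F}_q\to\mathbb{C}^\times$ a nontrivial additive character, $G_n=GL(n,\mathbb{F}_q)$, $U_n$ the subgroup of upper-triangular unipotent matrices, $B_n^-$ the subgroup of lower-triangular invertible matrices, and $T_n$ the subgroup of diagonal matrices. Extend $\psi$ to a character of $U_n$ by $\psi(u)=\psi(\sum_{i=1}^{n-1}u_{i,i+1})$. For $n_1+\cdots+n_s=n$ ($n_i>0$) and $c_1,\dots,c_s\in\mathbb{F}_q^\times$, $g_{n_1,\dots,n_s}(c_1,\dots,c_s)\in G_n$ is the block anti-diagonal matrix whose anti-diagonal blocks, from top right to bottom left, are $c_1I_{n_1},c_2I_{n_2},\dots,c_sI_{n_s}$. An irreducible representation $\pi$ of $G_n$ is generic if it is isomorphic to a subrepresentation of $\mathrm{Ind}_{U_n}^{G_n}\psi=\{f:G_n\to\mathbb{C}\mid f(ug)=\psi(u)f(g)\ \forall u\in U_n, g\in G_n\}$ (with $G_n$ acting by right translation); this representation is multiplicity-free, and $\mathcal{W}(\pi,\psi)$ denotes the unique subspace isomorphic to $\pi$. The Bessel function $J_\pi$ is the unique element of $\mathcal{W}(\pi,\psi)$ with $J_\pi(I_n)=1$ and $J_\pi(u_1gu_2)=\psi(u_1u_2)J_\pi(g)$ for all $u_1,u_2\in U_n$, $g\in G_n$. For a character $\underline{\chi}_n=(\chi_1,\dots,\chi_n)$ of $T_n$ (each $\chi_i$ a character of $\mathbb{F}_q^\times$, $\underline{\chi}_n(\mathrm{diag}(a_1,\dots,a_n))=\prod_i\chi_i(a_i)$),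 extend it to $B_n^-$ via the diagonal entries and let $\mathcal{V}_{\underline{\chi}_n}=\mathrm{Ind}_{B_n^-}^{G_n}\underline{\chi}_n=\{f:G_n\to\mathbb{C}\mid f(bg)=\underline{\chi}_n(b)f(g)\ \forall b\in B_n^-, g\in G_n\}$ with the right translation action. It has exactly one irreducible constituent in common with $\mathrm{Ind}_{U_n}^{G_n}\psi$, denoted $\pi^S_{\underline{\chi}_n}$. Let $e_{\psi_n}=\frac{1}{|U_n|}\sum_{u\in U_n}\overline{\psi(u)}\,u\in\mathbb{C}[G_n]$. The elements $e_{\psi_n}g_{n_1,\dots,n_s}(c_1,\dots,c_s)e_{\psi_n}$ form a basis of $e_{\psi_n}\mathbb{C}[G_n]e_{\psi_n}$. For each character $\underline{\chi}_n$ of $T_n$, let $f_{T_n,\underline{\chi}_n}:e_{\psi_n}\mathbb{C}[G_n]e_{\psi_n}\to\mathbb{C}$ be the algebra homomorphism with $f_{T_n,\underline{\chi}_n}(e_{\psi_n}ge_{\psi_n})=J_{\pi^S_{\underline{\chi}_n}}(g)$ for $g=g_{n_1,\dots,n_s}(c_1,\dots,c_s)$. The Curtis homomorphism $f_{T_n}:e_{\psi_n}\mathbb{C}[G_n]e_{\psi_n}\to\mathbb{C}[T_n]$, $c\mapsto\sum_{t\in T_n}f_{T_n}(c)(t)\,t$, is the unique algebra homomorphism (independent of $\underline{\chi}_n$; its existence is a theorem of Curtis) such that $\widehat{\underline{\chi}_n}\circ f_{T_n}=f_{T_n,\underline{\chi}_n}$ for every character $\underline{\chi}_n$ of $T_n$,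 where $\widehat{\underline{\chi}_n}:\mathbb{C}[T_n]\to\mathbb{C}$ is the linear extension of $\underline{\chi}_n$. *)

theory Defs
  imports
    Complex_Main
    "HOL-Library.FuncSet"
    "HOL-Library.Cardinality"
    "HOL-Library.Function_Algebras"
    "HOL-Algebra.Module"
    "Jordan_Normal_Form.Determinant"
begin

subsection \<open>The group and its subgroups\<close>

text \<open>All matrix indices start at 0, as in the matrix library.\<close>

definition GL :: "nat \<Rightarrow> 'a :: field mat monoid" where
  "GL n = units_of (ring_mat TYPE('a) n ())"

definition unipotent_grp :: "nat \<Rightarrow> 'a :: field mat set" where
  "unipotent_grp n = {A \<in> carrier (GL n). upper_triangular A \<and> (\<forall>i<n. A $$ (i, i) = 1)}"

definition lower_borel :: "nat \<Rightarrow> 'a :: field mat set" where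
  "lower_borel n = {A \<in> carrier (GL n). upper_triangular (transpose_mat A)}"

definition diag_torus :: "nat \<Rightarrow> 'a :: field mat set" where
  "diag_torus n = {A \<in> carrier (GL n). diagonal_mat A}"

definition torus_grp :: "nat \<Rightarrow> 'a :: field mat monoid" where
  "torus_grp n = (GL n)\<lparr>carrier := diag_torus n\<rparr>"

definition mat_trace :: "'a :: comm_monoid_add mat \<Rightarrow> 'a" where
  "mat_trace A = (\<Sum>i<dim_row A. A $$ (i, i))"

text \<open>\<open>anti_block [(n\<^sub>1, c\<^sub>1), \<dots>, (n\<^sub>s, c\<^sub>s)]\<close> has the blocks \<open>c\<^sub>1 I\<close>, \dots, \<open>c\<^sub>s I\<close> on the
  anti-diagonal, from top right to bottom left.\<close>

fun anti_block :: "(nat \<times> 'a :: field) list \<Rightarrow> 'a mat" where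
  "anti_block [] = 0\<^sub>m 0 0"
| "anti_block ((m, c) # bs) =
     (let r = sum_list (map fst bs) in
        four_block_mat (0\<^sub>m m r) (c \<cdot>\<^sub>m 1\<^sub>m m) (anti_block bs) (0\<^sub>m r m))"

definition composition_data :: "nat \<Rightarrow> (nat \<times> 'a :: field) list \<Rightarrow> bool" where
  "composition_data n bs \<longleftrightarrow>
     (\<forall>(m, c) \<in> set bs. 0 < m \<and> c \<noteq> 0) \<and> sum_list (map fst bs) = n"


subsection \<open>Characters\<close>

definition additive_character :: "('a :: field \<Rightarrow> complex) \<Rightarrow> bool" where
  "additive_character \<psi> \<longleftrightarrow> (\<forall>x. \<psi> x \<noteq> 0) \<and> (\<forall>x y. \<psi> (x + y) = \<psi> x * \<psi> y)"

definition nontrivial_additive_character :: "('a :: field \<Rightarrow> complex) \<Rightarrow> bool" where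
  "nontrivial_additive_character \<psi> \<longleftrightarrow> additive_character \<psi> \<and> (\<exists>x. \<psi> x \<noteq> 1)"

text \<open>A character of the multiplicative group; its value at 0 is irrelevant.\<close>

definition mult_character :: "('a :: field \<Rightarrow> complex) \<Rightarrow> bool" where
  "mult_character \<chi> \<longleftrightarrow>
     (\<forall>x. x \<noteq> 0 \<longrightarrow> \<chi> x \<noteq> 0) \<and>
     (\<forall>x y. x \<noteq> 0 \<longrightarrow> y \<noteq> 0 \<longrightarrow> \<chi> (x * y) = \<chi> x * \<chi> y)"

definition unip_char :: "nat \<Rightarrow> ('a :: field \<Rightarrow> complex) \<Rightarrow> 'a mat \<Rightarrow> complex" where
  "unip_char n \<psi> u = \<psi> (\<Sum>i<n - 1. u $$ (i, i + 1))"

text \<open>The character of the torus given by a tuple, and likewise its extension to the lower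
  Borel subgroup: both only look at the diagonal entries.\<close>

definition diag_char :: "nat \<Rightarrow> (nat \<Rightarrow> 'a :: field \<Rightarrow> complex) \<Rightarrow> 'a mat \<Rightarrow> complex" where
  "diag_char n \<chi> b = (\<Prod>i<n. \<chi> i (b $$ (i, i)))"


subsection \<open>Representations on spaces of functions on a group\<close>

text \<open>Functions \<open>G \<rightarrow> \<complex>\<close> are represented by functions on the ambient type that vanish outside
  \<open>carrier G\<close>. The representations considered are complex subspaces of this function space,
  stable under right translation.\<close>

definition fscale :: "complex \<Rightarrow> ('g \<Rightarrow> complex) \<Rightarrow> 'g \<Rightarrow> complex" where
  "fscale c f = (\<lambda>x. c * f x)"

interpretation cfun: vector_space fscale
  by standard (auto simp: fscale_def fun_eq_iff algebra_simps)

definition group_functions :: "('g, 'b) monoid_scheme \<Rightarrow> ('g \<Rightarrow> complex) set" where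
  "group_functions G = {f. \<forall>x. x \<notin> carrier G \<longrightarrow> f x = 0}"

definition rtrans :: "('g, 'b) monoid_scheme \<Rightarrow> 'g \<Rightarrow> ('g \<Rightarrow> complex) \<Rightarrow> 'g \<Rightarrow> complex" where
  "rtrans G h f = (\<lambda>x. if x \<in> carrier G then f (x \<otimes>\<^bsub>G\<^esub> h) else 0)"

definition subrep ::
  "('g, 'b) monoid_scheme \<Rightarrow> ('g \<Rightarrow> complex) set \<Rightarrow> ('g \<Rightarrow> complex) set \<Rightarrow> bool" where
  "subrep G W V \<longleftrightarrow>
     W \<subseteq> V \<and> cfun.subspace W \<and> (\<forall>f\<in>W. \<forall>h\<in>carrier G. rtrans G h f \<in> W)"

definition irreducible_rep ::
  "('g, 'b) monoid_scheme \<Rightarrow> ('g \<Rightarrow> complex) set \<Rightarrow> bool" where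
  "irreducible_rep G V \<longleftrightarrow>
     subrep G V (group_functions G) \<and> V \<noteq> {0} \<and> (\<forall>W. subrep G W V \<longrightarrow> W = {0} \<or> W = V)"

definition rep_iso ::
  "('g, 'b) monoid_scheme \<Rightarrow> ('g \<Rightarrow> complex) set \<Rightarrow> ('g \<Rightarrow> complex) set \<Rightarrow> bool" where
  "rep_iso G V W \<longleftrightarrow>
     (\<exists>\<phi>. bij_betw \<phi> V W \<and>
          (\<forall>f\<in>V. \<forall>g\<in>V. \<phi> (f + g) = \<phi> f + \<phi> g) \<and>
          (\<forall>c. \<forall>f\<in>V. \<phi> (fscale c f) = fscale c (\<phi> f)) \<and>
          (\<forall>h\<in>carrier G. \<forall>f\<in>V. \<phi> (rtrans G h f) = rtrans G h (\<phi> f)))"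

definition induced_rep ::
  "('g, 'b) monoid_scheme \<Rightarrow> 'g set \<Rightarrow> ('g \<Rightarrow> complex) \<Rightarrow> ('g \<Rightarrow> complex) set" where
  "induced_rep G H \<theta> =
     {f \<in> group_functions G. \<forall>h\<in>H. \<forall>g\<in>carrier G. f (h \<otimes>\<^bsub>G\<^esub> g) = \<theta> h * f g}"


subsection \<open>Generic representations, Whittaker models and Bessel functions\<close>

definition gelfand_graev ::
  "nat \<Rightarrow> ('a :: field \<Rightarrow> complex) \<Rightarrow> ('a mat \<Rightarrow> complex) set" where
  "gelfand_graev n \<psi> = induced_rep (GL n) (unipotent_grp n) (unip_char n \<psi>)"

definition generic_rep ::
  "nat \<Rightarrow> ('a :: field \<Rightarrow> complex) \<Rightarrow> ('a mat \<Rightarrow> complex) set \<Rightarrow> bool" where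
  "generic_rep n \<psi> \<pi> \<longleftrightarrow>
     irreducible_rep (GL n) \<pi> \<and>
     (\<exists>W. subrep (GL n) W (gelfand_graev n \<psi>) \<and> rep_iso (GL n) \<pi> W)"

definition whittaker_model ::
  "nat \<Rightarrow> ('a :: field \<Rightarrow> complex) \<Rightarrow> ('a mat \<Rightarrow> complex) set \<Rightarrow> ('a mat \<Rightarrow> complex) set" where
  "whittaker_model n \<psi> \<pi> =
     (THE W. subrep (GL n) W (gelfand_graev n \<psi>) \<and> rep_iso (GL n) \<pi> W)"

definition bessel_function ::
  "nat \<Rightarrow> ('a :: field \<Rightarrow> complex) \<Rightarrow> ('a mat \<Rightarrow> complex) set \<Rightarrow> 'a mat \<Rightarrow> complex" where
  "bessel_function n \<psi> \<pi> =
     (THE J. J \<in> whittaker_model n \<psi> \<pi> \<and> J (1\<^sub>m n) = 1 \<and>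
        (\<forall>u\<^sub>1\<in>unipotent_grp n. \<forall>u\<^sub>2\<in>unipotent_grp n. \<forall>g\<in>carrier (GL n).
           J (u\<^sub>1 * g * u\<^sub>2) = unip_char n \<psi> (u\<^sub>1 * u\<^sub>2) * J g))"

definition principal_series ::
  "nat \<Rightarrow> (nat \<Rightarrow> 'a :: field \<Rightarrow> complex) \<Rightarrow> ('a mat \<Rightarrow> complex) set" where
  "principal_series n \<chi> = induced_rep (GL n) (lower_borel n) (diag_char n \<chi>)"

text \<open>The irreducible constituent common to the principal series and the Gelfand-Graev
  representation is determined up to isomorphism; \<open>generic_constituent\<close> is a representative
  realised inside the principal series. Constituents are taken to be irreducible
  subrepresentations, by complete reducibility.\<close>

definition generic_constituent ::
  "nat \<Rightarrow> ('a :: field \<Rightarrow> complex) \<Rightarrow> (nat \<Rightarrow> 'a \<Rightarrow> complex) \<Rightarrow> ('a mat \<Rightarrow> complex) set" where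
  "generic_constituent n \<psi> \<chi> =
     (SOME \<pi>. subrep (GL n) \<pi> (principal_series n \<chi>) \<and> generic_rep n \<psi> \<pi>)"


subsection \<open>Group algebras and the Hecke algebra\<close>

definition delta :: "'g \<Rightarrow> 'g \<Rightarrow> complex" where
  "delta g = (\<lambda>x. if x = g then 1 else 0)"

text \<open>The element \<open>\<Sum> c(g) g\<close> of \<open>\<complex>[G]\<close> is represented by the coefficient function \<open>c\<close>.
  The sum in \<open>convol\<close> is empty when \<open>x \<notin> carrier G\<close>.\<close>

definition convol ::
  "('g, 'b) monoid_scheme \<Rightarrow> ('g \<Rightarrow> complex) \<Rightarrow> ('g \<Rightarrow> complex) \<Rightarrow> 'g \<Rightarrow> complex" where
  "convol G a b =
     (\<lambda>x. \<Sum>(y, z) \<in> {(y, z) \<in> carrier G \<times> carrier G. y \<otimes>\<^bsub>G\<^esub> z = x}. a y * b z)"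

definition group_algebra ::
  "('g, 'b) monoid_scheme \<Rightarrow> (complex, 'g \<Rightarrow> complex) module" where
  "group_algebra G =
     \<lparr>carrier = group_functions G, mult = convol G, one = delta \<one>\<^bsub>G\<^esub>,
      zero = 0, add = (+), Module.module.smult = fscale\<rparr>"

definition complex_algebra :: "(complex, complex) module" where
  "complex_algebra =
     \<lparr>carrier = UNIV, mult = (*), one = 1, zero = 0, add = (+), Module.module.smult = (*)\<rparr>"

definition algebra_hom ::
  "(complex, 'm) module \<Rightarrow> (complex, 'k) module \<Rightarrow> ('m \<Rightarrow> 'k) set" where
  "algebra_hom A B =
     {f \<in> ring_hom A B. \<forall>c. \<forall>x\<in>carrier A. f (c \<odot>\<^bsub>A\<^esub> x) = c \<odot>\<^bsub>B\<^esub> f x}"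

definition e_psi :: "nat \<Rightarrow> ('a :: field \<Rightarrow> complex) \<Rightarrow> 'a mat \<Rightarrow> complex" where
  "e_psi n \<psi> =
     (\<lambda>u. if u \<in> unipotent_grp n
          then cnj (unip_char n \<psi> u) / of_nat (card (unipotent_grp n :: 'a mat set)) else 0)"

definition e_sandwich ::
  "nat \<Rightarrow> ('a :: field \<Rightarrow> complex) \<Rightarrow> ('a mat \<Rightarrow> complex) \<Rightarrow> 'a mat \<Rightarrow> complex" where
  "e_sandwich n \<psi> a = convol (GL n) (convol (GL n) (e_psi n \<psi>) a) (e_psi n \<psi>)"

definition hecke_algebra ::
  "nat \<Rightarrow> ('a :: field \<Rightarrow> complex) \<Rightarrow> (complex, 'a mat \<Rightarrow> complex) module" where
  "hecke_algebra n \<psi> =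
     (group_algebra (GL n))
       \<lparr>carrier := e_sandwich n \<psi> ` group_functions (GL n), one := e_psi n \<psi>\<rparr>"


subsection \<open>The Curtis homomorphism\<close>

definition curtis_character ::
  "nat \<Rightarrow> ('a :: field \<Rightarrow> complex) \<Rightarrow> (nat \<Rightarrow> 'a \<Rightarrow> complex) \<Rightarrow>
     (('a mat \<Rightarrow> complex) \<Rightarrow> complex) \<Rightarrow> bool" where
  "curtis_character n \<psi> \<chi> \<phi> \<longleftrightarrow>
     \<phi> \<in> algebra_hom (hecke_algebra n \<psi>) complex_algebra \<and>
     (\<forall>bs. composition_data n bs \<longrightarrow>
        \<phi> (e_sandwich n \<psi> (delta (anti_block bs))) =
          bessel_function n \<psi> (generic_constituent n \<psi> \<chi>) (anti_block bs))"

definition char_extension ::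
  "nat \<Rightarrow> (nat \<Rightarrow> 'a :: field \<Rightarrow> complex) \<Rightarrow> ('a mat \<Rightarrow> complex) \<Rightarrow> complex" where
  "char_extension n \<chi> c = (\<Sum>t\<in>diag_torus n. c t * diag_char n \<chi> t)"

text \<open>Since \<open>curtis_character n \<psi> \<chi>\<close> pins down a unique map on the Hecke algebra (its
  prescribed values are those on a basis), the last condition says that the composite of
  \<open>F\<close> with the linear extension of \<open>\<chi>\<close> equals that map.\<close>

definition curtis_homomorphism ::
  "nat \<Rightarrow> ('a :: field \<Rightarrow> complex) \<Rightarrow> (('a mat \<Rightarrow> complex) \<Rightarrow> 'a mat \<Rightarrow> complex) \<Rightarrow> bool" where
  "curtis_homomorphism n \<psi> F \<longleftrightarrow>
     F \<in> algebra_hom (hecke_algebra n \<psi>) (group_algebra (torus_grp n)) \<and>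
     (\<forall>\<chi>. (\<forall>i<n. mult_character (\<chi> i)) \<longrightarrow>
        curtis_character n \<psi> \<chi> (\<lambda>c. char_extension n \<chi> (F c)))"


subsection \<open>The parametrisation and the Gelfand-Tsetlin diagram\<close>

text \<open>Here \<open>y j\<close>, for \<open>1 \<le> j < n\<close>, stands for \<open>y\<^sub>j\<^sub>,\<^sub>j\<close>.\<close>

definition torus_param :: "nat \<Rightarrow> 'a :: field \<Rightarrow> (nat \<Rightarrow> 'a) \<Rightarrow> 'a mat" where
  "torus_param n a y =
     mat_diag n (\<lambda>i. if i = 0 then y 1
                     else if i < n - 1 then - (y (i + 1) / y i)
                     else - (a / y (n - 1)))"

datatype 'a arrow = Horizontal 'a 'a | Vertical 'a 'a

fun arrow_weight :: "'a :: field arrow \<Rightarrow> 'a" where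
  "arrow_weight (Horizontal x y) = - (x / y)"
| "arrow_weight (Vertical x y) = x / y"

definition gt_diagram :: "nat \<Rightarrow> 'a :: field \<Rightarrow> (nat \<Rightarrow> 'a) \<Rightarrow> 'a arrow list" where
  "gt_diagram n a y =
     (let nodes = map y [1..<n] @ [a]
      in Vertical 1 (y 1) # map2 Horizontal nodes (tl nodes))"

end

theory Submission
  imports Defs "HOL-Algebra.Multiplicative_Group"
begin

text \<open>The principal series of \<open>\<chi>\<close> has, up to scalars, a single vector \<open>w\<close> on which the unipotent
  group acts by \<open>\<psi>\<close>; it is supported on the big cell, where \<open>w (b * u) = \<chi> b * \<psi> u\<close>. Hence the
  generic constituent is the subrepresentation generated by \<open>w\<close>, multiplicity one holds for it, and
  its Bessel function at \<open>g\<close> is the average of \<open>cnj (\<psi> u) * w (u * g)\<close> over \<open>u\<close>. For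
  \<open>g = g\<^sub>n\<^sub>-\<^sub>1\<^sub>,\<^sub>1(1, a)\<close> the summand only depends on the last column of \<open>u\<close>, and the factorisation of
  \<open>u * g\<close> into lower and upper triangular matrices is explicit. This exhibits the Bessel function as
  the Fourier transform in \<open>\<chi>\<close> of the asserted function on the torus, and Fourier inversion on the
  torus concludes.\<close>

subsection \<open>Whittaker vectors in an induced representation\<close>

text \<open>\<open>bessel_function\<close>, \<open>whittaker_model\<close> and
  \<open>generic_constituent\<close> are given by \<open>THE\<close> and \<open>SOME\<close>, so
  before anything is computed every admissible choice must be shown to give the same function. All
  of this follows from the locale assumption \<open>w_unique\<close>: the Whittaker vectors of the
  induced representation form a line. Inducing from the lower rather than the upper Borel subgroup
  puts the identity into the big cell, so that the vector can be normalised by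
  \<open>w \<one> = 1\<close> and coefficients are read off at \<one>.

  The constants of the formula arise as follows. The power of q is the number of last columns of
  unipotent matrices. A column with a zero entry takes \<open>u * g\<close> out of the big cell, and
  multiplying the entries of the others by \<open>a\<close> turns them into tuples of nonzero
  \<open>y\<close>. The exponent, the trace of the inverse, has two sources: the superdiagonal of
  the upper factor gives all terms but the last, and the last comes from
  \<open>cnj (\<psi> (y (n - 1) / a))\<close>.\<close>

locale whittaker_setup = group G for G :: "('g, 'b) monoid_scheme" (structure) +
  fixes U B :: "'g set" and \<theta> \<chi> :: "'g \<Rightarrow> complex" and w :: "'g \<Rightarrow> complex"
  assumes finite_carrier: "finite (carrier G)"
    and subgroup_U: "subgroup U G"
    and \<theta>_mult: "\<And>u v. u \<in> U \<Longrightarrow> v \<in> U \<Longrightarrow> \<theta> (u \<otimes> v) = \<theta> u * \<theta> v"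
    and \<theta>_norm: "\<And>u. u \<in> U \<Longrightarrow> norm (\<theta> u) = 1"
    and w_in: "w \<in> induced_rep G B \<chi>"
    and w_right: "\<And>g u. g \<in> carrier G \<Longrightarrow> u \<in> U \<Longrightarrow> w (g \<otimes> u) = \<theta> u * w g"
    and w_one: "w \<one> = 1"
    and w_unique: "\<And>f. f \<in> induced_rep G B \<chi> \<Longrightarrow>
      (\<And>g u. g \<in> carrier G \<Longrightarrow> u \<in> U \<Longrightarrow> f (g \<otimes> u) = \<theta> u * f g) \<Longrightarrow> f = fscale (f \<one>) w"
    and subgroup_B: "subgroup B G"
begin

section \<open>Averaging over \<open>U\<close> from the left and from the right\<close>

abbreviation V where "V \<equiv> induced_rep G B \<chi>"
abbreviation GG where "GG \<equiv> induced_rep G U \<theta>"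

text \<open>The average is taken on the left, so it commutes with right translation. This is the
  intertwiner that carries \<open>wspan\<close> into \<open>GG\<close>.\<close>

definition wavg :: "('g \<Rightarrow> complex) \<Rightarrow> 'g \<Rightarrow> complex" where
  "wavg f = (\<lambda>x. if x \<in> carrier G
     then (\<Sum>u\<in>U. cnj (\<theta> u) * f (u \<otimes> x)) / of_nat (card U) else 0)"

text \<open>The idempotent of \<theta> acting through right translation. It is written as a
  combination of the operators \<open>rtrans G u\<close> so that subrepresentations are visibly
  stable under it and intertwiners commute with it.\<close>

definition wproj :: "('g \<Rightarrow> complex) \<Rightarrow> 'g \<Rightarrow> complex" where
  "wproj f = fscale (1 / of_nat (card U)) (\<Sum>u\<in>U. fscale (cnj (\<theta> u)) (rtrans G u f))"

definition wspan :: "('g \<Rightarrow> complex) set" where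
  "wspan = cfun.span ((\<lambda>g. rtrans G g w) ` carrier G)"

lemma U_carrier: "u \<in> U \<Longrightarrow> u \<in> carrier G"
  using subgroup_U by (simp add: subgroup.mem_carrier)

lemma B_carrier: "b \<in> B \<Longrightarrow> b \<in> carrier G"
  using subgroup_B by (simp add: subgroup.mem_carrier)

lemma finite_U: "finite U"
  using finite_carrier U_carrier by (meson finite_subset subsetI)

lemma card_U: "card U \<noteq> 0"
  using subgroup.finite_imp_card_positive[OF subgroup_U finite_carrier] by simp

lemma \<theta>_cnj: "u \<in> U \<Longrightarrow> cnj (\<theta> u) * \<theta> u = 1"
  using \<theta>_norm[of u] complex_norm_square[of "\<theta> u"] by (simp add: mult.commute)

lemma \<theta>_one: "\<theta> \<one> = 1"
proof -
  have "\<one> \<in> U" using subgroup_U by (simp add: subgroup.one_closed)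
  then show ?thesis using \<theta>_mult[of \<one> \<one>] \<theta>_norm[of \<one>] by auto
qed

lemma \<theta>_inv: "u \<in> U \<Longrightarrow> \<theta> (inv u) = cnj (\<theta> u)"
proof -
  assume u: "u \<in> U"
  then have "\<theta> (inv u) * \<theta> u = 1"
    using \<theta>_mult[of "inv u" u] subgroup_U by (simp add: subgroup.m_inv_closed U_carrier \<theta>_one)
  with \<theta>_cnj[OF u] show ?thesis
    by (metis mult_right_cancel mult_zero_right zero_neq_one)
qed

lemma bij_right_mult_U: "v \<in> U \<Longrightarrow> bij_betw (\<lambda>u. u \<otimes> v) U U"
  by (rule bij_betwI[where g = "\<lambda>u. u \<otimes> inv v"])
    (auto simp: U_carrier m_assoc subgroup.m_closed[OF subgroup_U]
      subgroup.m_inv_closed[OF subgroup_U])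

lemma bij_left_mult_U: "v \<in> U \<Longrightarrow> bij_betw (\<lambda>u. v \<otimes> u) U U"
  by (rule bij_betwI[where g = "\<lambda>u. inv v \<otimes> u"])
    (auto simp: U_carrier m_assoc[symmetric] subgroup.m_closed[OF subgroup_U]
      subgroup.m_inv_closed[OF subgroup_U])

lemma bij_inv_U: "bij_betw (\<lambda>u. inv u) U U"
  by (rule bij_betwI[where g = "\<lambda>u. inv u"])
    (auto simp: U_carrier subgroup.m_inv_closed[OF subgroup_U])

lemma bij_right_mult: "h \<in> carrier G \<Longrightarrow> bij_betw (\<lambda>x. x \<otimes> h) (carrier G) (carrier G)"
  by (rule bij_betwI[where g = "\<lambda>x. x \<otimes> inv h"]) (auto simp: m_assoc)

lemma sum_fun_apply: "(\<Sum>i\<in>A. f i) x = (\<Sum>i\<in>A. f i x)" for f :: "'i \<Rightarrow> 'x \<Rightarrow> complex"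
  by (induction A rule: infinite_finite_induct) auto

lemma rtrans_add: "rtrans G h (f + f') = rtrans G h f + rtrans G h f'"
  by (auto simp: rtrans_def fun_eq_iff)

lemma rtrans_scale: "rtrans G h (fscale c f) = fscale c (rtrans G h f)"
  by (auto simp: rtrans_def fscale_def fun_eq_iff)

lemma rtrans_rtrans: "g \<in> carrier G \<Longrightarrow> h \<in> carrier G \<Longrightarrow>
  rtrans G g (rtrans G h f) = rtrans G (g \<otimes> h) f"
  by (auto simp: rtrans_def fun_eq_iff m_assoc)

lemma rtrans_one: "f \<in> group_functions G \<Longrightarrow> rtrans G \<one> f = f"
  by (auto simp: rtrans_def fun_eq_iff group_functions_def)

lemma wproj_apply: "wproj f x = (if x \<in> carrier G
     then (\<Sum>u\<in>U. cnj (\<theta> u) * f (x \<otimes> u)) / of_nat (card U) else 0)"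
  by (auto simp: wproj_def fscale_def sum_fun_apply rtrans_def)

lemma subspace_induced: "cfun.subspace (induced_rep G H \<eta>)"
  by (auto simp: cfun.subspace_def induced_rep_def group_functions_def fscale_def algebra_simps)

lemma rtrans_induced:
  assumes "H \<subseteq> carrier G" "f \<in> induced_rep G H \<eta>" "h \<in> carrier G"
  shows "rtrans G h f \<in> induced_rep G H \<eta>"
  using assms by (auto simp: induced_rep_def group_functions_def rtrans_def m_assoc subset_iff)

lemma V_group_functions: "V \<subseteq> group_functions G"
  by (auto simp: induced_rep_def)

lemma wproj_closed:
  assumes "cfun.subspace S" "\<And>h. h \<in> carrier G \<Longrightarrow> rtrans G h f \<in> S"
  shows "wproj f \<in> S"
  unfolding wproj_def using assms
  by (intro cfun.subspace_scale cfun.subspace_sum) (auto simp: U_carrier)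

lemma wproj_equivariant:
  assumes "g \<in> carrier G" "v \<in> U"
  shows "wproj f (g \<otimes> v) = \<theta> v * wproj f g"
proof -
  have "(\<Sum>u\<in>U. cnj (\<theta> u) * f (g \<otimes> v \<otimes> u)) = (\<Sum>u\<in>U. \<theta> v * (cnj (\<theta> (v \<otimes> u)) * f (g \<otimes> (v \<otimes> u))))"
  proof (rule sum.cong[OF refl])
    fix u assume u: "u \<in> U"
    have "\<theta> v * cnj (\<theta> (v \<otimes> u)) = cnj (\<theta> u)"
      using \<theta>_cnj[OF assms(2)] by (simp add: \<theta>_mult[OF assms(2) u] mult.assoc[symmetric] mult.commute)
    then show "cnj (\<theta> u) * f (g \<otimes> v \<otimes> u) = \<theta> v * (cnj (\<theta> (v \<otimes> u)) * f (g \<otimes> (v \<otimes> u)))"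
      using assms u by (simp add: mult.assoc[symmetric] m_assoc U_carrier)
  qed
  also have "\<dots> = \<theta> v * (\<Sum>u\<in>U. cnj (\<theta> u) * f (g \<otimes> u))"
    using sum.reindex_bij_betw[OF bij_left_mult_U[OF assms(2)], of "\<lambda>u. cnj (\<theta> u) * f (g \<otimes> u)"]
    by (simp flip: sum_distrib_left)
  finally show ?thesis using assms by (simp add: wproj_apply U_carrier)
qed

lemma wavg_equivariant:
  assumes "g \<in> carrier G" "v \<in> U"
  shows "wavg f (v \<otimes> g) = \<theta> v * wavg f g"
proof -
  have "(\<Sum>u\<in>U. cnj (\<theta> u) * f (u \<otimes> (v \<otimes> g))) = (\<Sum>u\<in>U. \<theta> v * (cnj (\<theta> (u \<otimes> v)) * f ((u \<otimes> v) \<otimes> g)))"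
  proof (rule sum.cong[OF refl])
    fix u assume u: "u \<in> U"
    have "\<theta> v * cnj (\<theta> (u \<otimes> v)) = cnj (\<theta> u)"
      using \<theta>_cnj[OF assms(2)] by (simp add: \<theta>_mult[OF u assms(2)] algebra_simps)
    then show "cnj (\<theta> u) * f (u \<otimes> (v \<otimes> g)) = \<theta> v * (cnj (\<theta> (u \<otimes> v)) * f ((u \<otimes> v) \<otimes> g))"
      using assms u by (simp add: mult.assoc[symmetric] m_assoc U_carrier)
  qed
  also have "\<dots> = \<theta> v * (\<Sum>u\<in>U. cnj (\<theta> u) * f (u \<otimes> g))"
    using sum.reindex_bij_betw[OF bij_right_mult_U[OF assms(2)], of "\<lambda>u. cnj (\<theta> u) * f (u \<otimes> g)"]
    by (simp flip: sum_distrib_left)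
  finally show ?thesis using assms by (simp add: wavg_def U_carrier)
qed

lemma wavg_in_GG: "wavg f \<in> GG"
  unfolding induced_rep_def group_functions_def
  using wavg_equivariant by (auto simp: wavg_def)

lemma wavg_add: "wavg (f + f') = wavg f + wavg f'"
  by (auto simp: wavg_def fun_eq_iff algebra_simps sum.distrib add_divide_distrib)

lemma wavg_scale: "wavg (fscale c f) = fscale c (wavg f)"
  by (auto simp: wavg_def fun_eq_iff fscale_def sum_distrib_left algebra_simps)

lemma wavg_rtrans: "h \<in> carrier G \<Longrightarrow> wavg (rtrans G h f) = rtrans G h (wavg f)"
  by (auto simp: wavg_def rtrans_def fun_eq_iff m_assoc U_carrier intro!: sum.cong)

lemma wproj_rtrans_one: "g \<in> carrier G \<Longrightarrow> wproj (rtrans G g f) \<one> = wavg f g"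
  by (auto simp: wproj_apply wavg_def rtrans_def U_carrier)

text \<open>The projection of any vector of \<open>V\<close> lies on the line of \<open>w\<close>,
  so it is determined by its value at \<one>, and that value is a left average of \<open>f\<close>.
  This ties the two averages together and carries the rest of the locale.\<close>

lemma wproj_rtrans:
  assumes "f \<in> V" "g \<in> carrier G"
  shows "wproj (rtrans G g f) = fscale (wavg f g) w"
proof -
  have "rtrans G h (rtrans G g f) \<in> V" if "h \<in> carrier G" for h
    using that assms B_carrier by (intro rtrans_induced) auto
  then have "wproj (rtrans G g f) \<in> V"
    by (intro wproj_closed subspace_induced)
  from w_unique[OF this wproj_equivariant] show ?thesis
    using wproj_rtrans_one[OF assms(2)] by simp
qed

lemma wproj_w: "wproj w = w"
proof -
  have "(\<Sum>u\<in>U. cnj (\<theta> u) * w (x \<otimes> u)) = of_nat (card U) * w x" if "x \<in> carrier G" for x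
    using that \<theta>_cnj by (simp add: w_right mult.assoc[symmetric])
  then show ?thesis
    using w_in card_U by (auto simp: wproj_apply fun_eq_iff induced_rep_def group_functions_def)
qed

lemma wavg_w_one: "wavg w \<one> = 1"
  using wproj_rtrans_one[of \<one> w] wproj_w w_one w_in V_group_functions rtrans_one[of w] by auto

section \<open>The subrepresentation generated by \<open>w\<close>\<close>

lemma subrep_wspan: "subrep G wspan V"
proof -
  have "rtrans G h f \<in> wspan" if "f \<in> wspan" "h \<in> carrier G" for f h
    using that(1) unfolding wspan_def
  proof (induction rule: cfun.span_induct_alt)
    case base
    have "rtrans G h 0 = 0" by (auto simp: rtrans_def)
    then show ?case using cfun.span_zero by metis
  next
    case (step c x y)
    then obtain g where g: "g \<in> carrier G" "x = rtrans G g w" by auto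
    have "rtrans G h x = rtrans G (h \<otimes> g) w" using g that(2) by (simp add: rtrans_rtrans)
    moreover have "h \<otimes> g \<in> carrier G" using g that(2) by simp
    ultimately have "rtrans G h x \<in> cfun.span ((\<lambda>g. rtrans G g w) ` carrier G)"
      by (auto intro: cfun.span_base)
    then show ?case using step unfolding rtrans_add rtrans_scale by (intro cfun.span_add cfun.span_scale)
  qed
  moreover have "wspan \<subseteq> V"
    unfolding wspan_def using rtrans_induced[OF _ w_in] B_carrier
    by (intro cfun.span_minimal subspace_induced) auto
  ultimately show ?thesis by (auto simp: subrep_def wspan_def)
qed

lemma w_in_wspan: "w \<in> wspan"
proof -
  have "rtrans G \<one> w = w" using w_in V_group_functions by (auto intro: rtrans_one)
  then show ?thesis unfolding wspan_def by (metis cfun.span_base imageI one_closed)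
qed

lemma wspan_minimal:
  assumes "subrep G S V'" "w \<in> S"
  shows "wspan \<subseteq> S"
  unfolding wspan_def using assms by (intro cfun.span_minimal) (auto simp: subrep_def)

text \<open>One nonvanishing average suffices: projecting the translate by that \<open>g\<close>
  stays in \<open>S\<close> and gives a nonzero multiple of \<open>w\<close>.\<close>

lemma w_in_subrep:
  assumes "subrep G S V" "f \<in> S" "g \<in> carrier G" "wavg f g \<noteq> 0"
  shows "w \<in> S"
proof -
  have "wproj (rtrans G g f) \<in> S"
    using assms by (intro wproj_closed) (auto simp: subrep_def)
  then have "fscale (1 / wavg f g) (fscale (wavg f g) w) \<in> S"
    using assms wproj_rtrans[of f g]
    by (metis cfun.subspace_scale subrep_def subsetD)
  then show ?thesis using assms(4) by simp
qed

text \<open>Replaces complete reducibility: by the invariance of the inner product under right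
  translation, a subrepresentation without Whittaker vectors is orthogonal to all translates of
  \<open>w\<close>, hence inside \<open>wspan\<close> to itself.\<close>

lemma orthogonal_wspan:
  assumes f: "f \<in> V" and 0: "\<And>g. g \<in> carrier G \<Longrightarrow> wavg f g = 0" and m: "m \<in> wspan"
  shows "(\<Sum>x\<in>carrier G. m x * cnj (f x)) = 0"
  using m unfolding wspan_def
proof (induction rule: cfun.span_induct_alt)
  case base
  then show ?case by simp
next
  case (step c m y)
  then obtain g where g: "g \<in> carrier G" "m = rtrans G g w" by auto
  \<comment> \<open>Translation invariance of the inner product moves \<open>g\<close> to the second
    argument.\<close>
  define h where "h = rtrans G (inv g) f"
  have "(\<Sum>x\<in>carrier G. m x * cnj (f x)) = (\<Sum>x\<in>carrier G. w (x \<otimes> g) * cnj (h (x \<otimes> g)))"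
    using g by (intro sum.cong) (auto simp: rtrans_def h_def m_assoc)
  also have "\<dots> = (\<Sum>x\<in>carrier G. w x * cnj (h x))"
    using sum.reindex_bij_betw[OF bij_right_mult[OF g(1)], of "\<lambda>x. w x * cnj (h x)"] by simp
  \<comment> \<open>\<open>w\<close> is replaced by its own projection in order to transfer the
    projection to \<open>h\<close>; it is self-adjoint because conjugating \<theta> amounts to
    inverting \<open>u\<close>.\<close>
  also have "\<dots> = (\<Sum>x\<in>carrier G. (\<Sum>u\<in>U. cnj (\<theta> u) * w (x \<otimes> u)) / of_nat (card U) * cnj (h x))"
  proof (rule sum.cong[OF refl])
    fix x assume "x \<in> carrier G"
    then have "w x = (\<Sum>u\<in>U. cnj (\<theta> u) * w (x \<otimes> u)) / of_nat (card U)"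
      using fun_cong[OF wproj_w, of x] by (simp only: wproj_apply if_True)
    then show "w x * cnj (h x) = (\<Sum>u\<in>U. cnj (\<theta> u) * w (x \<otimes> u)) / of_nat (card U) * cnj (h x)"
      by simp
  qed
  also have "\<dots> = (\<Sum>x\<in>carrier G. \<Sum>u\<in>U. cnj (\<theta> u) * w (x \<otimes> u) * cnj (h x)) / of_nat (card U)"
    by (simp add: sum_divide_distrib sum_distrib_right)
  also have "(\<Sum>x\<in>carrier G. \<Sum>u\<in>U. cnj (\<theta> u) * w (x \<otimes> u) * cnj (h x)) =
      (\<Sum>u\<in>U. \<Sum>x\<in>carrier G. cnj (\<theta> u) * w (x \<otimes> u) * cnj (h (x \<otimes> u \<otimes> inv u)))"
    by (subst sum.swap) (auto intro!: sum.cong simp: m_assoc U_carrier)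
  also have "\<dots> = (\<Sum>u\<in>U. \<Sum>x\<in>carrier G. cnj (\<theta> u) * w x * cnj (h (x \<otimes> inv u)))"
  proof (rule sum.cong[OF refl])
    fix u assume "u \<in> U"
    then show "(\<Sum>x\<in>carrier G. cnj (\<theta> u) * w (x \<otimes> u) * cnj (h (x \<otimes> u \<otimes> inv u))) =
        (\<Sum>x\<in>carrier G. cnj (\<theta> u) * w x * cnj (h (x \<otimes> inv u)))"
      using sum.reindex_bij_betw[OF bij_right_mult[OF U_carrier],
          of u "\<lambda>x. cnj (\<theta> u) * w x * cnj (h (x \<otimes> inv u))"] by simp
  qed
  also have "\<dots> = (\<Sum>x\<in>carrier G. \<Sum>u\<in>U. cnj (\<theta> (inv (inv u))) * w x * cnj (h (x \<otimes> inv u)))"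
    by (subst sum.swap) (auto intro!: sum.cong simp: U_carrier)
  also have "\<dots> = (\<Sum>x\<in>carrier G. \<Sum>u\<in>U. cnj (\<theta> (inv u)) * w x * cnj (h (x \<otimes> u)))"
  proof (rule sum.cong[OF refl])
    fix x
    show "(\<Sum>u\<in>U. cnj (\<theta> (inv (inv u))) * w x * cnj (h (x \<otimes> inv u))) =
        (\<Sum>u\<in>U. cnj (\<theta> (inv u)) * w x * cnj (h (x \<otimes> u)))"
      using sum.reindex_bij_betw[OF bij_inv_U, of "\<lambda>u. cnj (\<theta> (inv u)) * w x * cnj (h (x \<otimes> u))"] .
  qed
  also have "\<dots> = (\<Sum>x\<in>carrier G. of_nat (card U) * w x * cnj (wproj h x))"
  proof (rule sum.cong[OF refl])
    fix x assume "x \<in> carrier G"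
    then have "of_nat (card U) * cnj (wproj h x) = (\<Sum>u\<in>U. \<theta> u * cnj (h (x \<otimes> u)))"
      using card_U by (simp add: wproj_apply)
    then have "of_nat (card U) * w x * cnj (wproj h x) = w x * (\<Sum>u\<in>U. \<theta> u * cnj (h (x \<otimes> u)))"
      by (simp add: mult.commute mult.left_commute)
    then show "(\<Sum>u\<in>U. cnj (\<theta> (inv u)) * w x * cnj (h (x \<otimes> u))) =
        of_nat (card U) * w x * cnj (wproj h x)"
      by (simp add: \<theta>_inv sum_distrib_left mult_ac)
  qed
  \<comment> \<open>The projection of \<open>h\<close> is \<open>w\<close> times
    \<open>wavg f (inv g)\<close>, and all averages of \<open>f\<close> vanish.\<close>
  also have "wproj h = 0"
    using wproj_rtrans[OF f, of "inv g"] g(1) 0[of "inv g"] by (auto simp: h_def)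
  finally have "(\<Sum>x\<in>carrier G. m x * cnj (f x)) = 0" by simp
  then show ?case using step
    by (simp add: fscale_def ring_distribs sum.distrib mult.assoc sum_distrib_left[symmetric])
qed

text \<open>Such an \<open>f\<close> is perpendicular to all of \<open>wspan\<close>, which contains
  \<open>f\<close> itself.\<close>

lemma wavg_zero_imp_zero:
  assumes "f \<in> wspan" "\<And>g. g \<in> carrier G \<Longrightarrow> wavg f g = 0"
  shows "f = 0"
proof -
  have f: "f \<in> V" using assms(1) subrep_wspan by (auto simp: subrep_def)
  have "(\<Sum>x\<in>carrier G. f x * cnj (f x)) = 0"
    using orthogonal_wspan[OF f assms(2) assms(1)] by simp
  then have "complex_of_real (\<Sum>x\<in>carrier G. (norm (f x))\<^sup>2) = 0"
    by (simp add: of_real_sum complex_norm_square del: of_real_power)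
  then have "(\<Sum>x\<in>carrier G. (norm (f x))\<^sup>2) = 0"
    using of_real_eq_0_iff by blast
  then have "\<forall>x\<in>carrier G. f x = 0"
    using finite_carrier by (subst (asm) sum_nonneg_eq_0_iff) auto
  then show ?thesis
    using f V_group_functions by (auto simp: fun_eq_iff group_functions_def)
qed

text \<open>A stable subspace either contains \<open>w\<close>, and then everything generated by it,
  or has only zero averages, and then it is zero.\<close>

lemma irreducible_wspan: "irreducible_rep G wspan"
  unfolding irreducible_rep_def
proof (intro conjI allI impI)
  show "subrep G wspan (group_functions G)"
    using subrep_wspan V_group_functions by (auto simp: subrep_def)
  show "wspan \<noteq> {0}"
    using w_in_wspan w_one by (auto simp: fun_eq_iff)
next
  fix S assume S: "subrep G S wspan"
  then have SV: "subrep G S V" using subrep_wspan by (auto simp: subrep_def)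
  show "S = {0} \<or> S = wspan"
  proof (cases "w \<in> S")
    case True
    then show ?thesis using wspan_minimal[OF SV] S by (auto simp: subrep_def)
  next
    case False
    have "f = 0" if "f \<in> S" for f
      using w_in_subrep[OF SV that] False S that by (intro wavg_zero_imp_zero) (auto simp: subrep_def)
    moreover have "0 \<in> S" using S by (auto simp: subrep_def cfun.subspace_0)
    ultimately show ?thesis by auto
  qed
qed

section \<open>The Whittaker model and the Bessel function of \<open>wspan\<close>\<close>

lemma inj_on_wavg: "inj_on wavg wspan"
proof (rule inj_onI)
  fix f f' assume *: "f \<in> wspan" "f' \<in> wspan" "wavg f = wavg f'"
  have "f - f' \<in> wspan" using * by (simp add: wspan_def cfun.span_diff)
  moreover have "wavg (f - f') = 0"
    using * wavg_add[of "f - f'" f'] by simp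
  ultimately show "f = f'" using wavg_zero_imp_zero[of "f - f'"] by simp
qed

lemma subrep_wavg_image: "subrep G (wavg ` wspan) GG"
proof -
  have sub: "cfun.subspace wspan" using subrep_wspan by (simp add: subrep_def)
  have "cfun.subspace (wavg ` wspan)"
    unfolding cfun.subspace_def
  proof (intro conjI allI ballI)
    have "wavg 0 = 0" using wavg_scale[of 0 0] unfolding cfun.scale_zero_left .
    then show "0 \<in> wavg ` wspan"
      using cfun.subspace_0[OF sub] by (metis imageI)
    fix f f' assume "f \<in> wavg ` wspan" "f' \<in> wavg ` wspan"
    then obtain g g' where *: "g \<in> wspan" "g' \<in> wspan" "f = wavg g" "f' = wavg g'" by blast
    show "f + f' \<in> wavg ` wspan"
      using cfun.subspace_add[OF sub *(1,2)] unfolding *(3,4) wavg_add[symmetric] by (rule imageI)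
  next
    fix c f assume "f \<in> wavg ` wspan"
    then obtain g where *: "g \<in> wspan" "f = wavg g" by blast
    show "fscale c f \<in> wavg ` wspan"
      using cfun.subspace_scale[OF sub *(1)] unfolding *(2) wavg_scale[symmetric] by (rule imageI)
  qed
  then show ?thesis
    using wavg_in_GG subrep_wspan unfolding subrep_def
    by (auto simp: wavg_rtrans[symmetric])
qed

lemma rep_iso_wavg: "rep_iso G wspan (wavg ` wspan)"
  unfolding rep_iso_def
  using inj_on_wavg by (intro exI[of _ wavg]) (auto simp: bij_betw_def wavg_add wavg_scale wavg_rtrans)

text \<open>\<open>\<phi>\<close> is linear on \<open>S\<close> only, so the sum defining the
  projection is built up term by term, with membership of the partial sums in \<open>S\<close>
  carried along in the induction.\<close>

lemma hom_wproj:
  assumes S: "cfun.subspace S" "\<And>f h. f \<in> S \<Longrightarrow> h \<in> carrier G \<Longrightarrow> rtrans G h f \<in> S"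
    and add: "\<forall>f\<in>S. \<forall>g\<in>S. \<phi> (f + g) = \<phi> f + \<phi> g"
    and scale: "\<forall>c. \<forall>f\<in>S. \<phi> (fscale c f) = fscale c (\<phi> f)"
    and rtr: "\<forall>h\<in>carrier G. \<forall>f\<in>S. \<phi> (rtrans G h f) = rtrans G h (\<phi> f)"
    and f: "f \<in> S"
  shows "\<phi> (wproj f) = wproj (\<phi> f)"
proof -
  have zero: "\<phi> 0 = 0"
    using scale f by (metis cfun.scale_zero_left)
  have "\<phi> (\<Sum>u\<in>A. fscale (cnj (\<theta> u)) (rtrans G u f)) =
      (\<Sum>u\<in>A. fscale (cnj (\<theta> u)) (rtrans G u (\<phi> f))) \<and>
      (\<Sum>u\<in>A. fscale (cnj (\<theta> u)) (rtrans G u f)) \<in> S" if "finite A" "A \<subseteq> U" for A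
    using that
  proof (induction A rule: finite_induct)
    case empty
    then show ?case using zero cfun.subspace_0[OF S(1)] unfolding sum.empty by blast
  next
    case (insert u A)
    have "rtrans G u f \<in> S" using insert.prems f S U_carrier by auto
    then have 1: "fscale (cnj (\<theta> u)) (rtrans G u f) \<in> S"
      "\<phi> (fscale (cnj (\<theta> u)) (rtrans G u f)) = fscale (cnj (\<theta> u)) (rtrans G u (\<phi> f))"
      using insert.prems f S(1) U_carrier scale rtr by (auto intro: cfun.subspace_scale)
    have 2: "\<phi> (\<Sum>u\<in>A. fscale (cnj (\<theta> u)) (rtrans G u f)) =
      (\<Sum>u\<in>A. fscale (cnj (\<theta> u)) (rtrans G u (\<phi> f)))"
      "(\<Sum>u\<in>A. fscale (cnj (\<theta> u)) (rtrans G u f)) \<in> S"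
      using insert by auto
    show ?case unfolding sum.insert[OF insert.hyps]
      using cfun.subspace_add[OF S(1) 1(1) 2(2)] add[rule_format, OF 1(1) 2(2)]
      unfolding 1(2) 2(1) by blast
  qed
  from this[OF finite_U order_refl] show ?thesis
    by (simp add: wproj_def scale)
qed

text \<open>Elements of \<open>W\<close> are already \<theta>-equivariant on the left, so their
  value at \<open>g\<close> is found by translating by \<open>g\<close>, projecting and evaluating
  at \<one>. Since \<open>\<phi>\<close> commutes with the projection, whose image in
  \<open>V\<close> is the line of \<open>w\<close>, the map \<open>\<phi>\<close> is a multiple of
  \<open>wavg\<close>; being injective on a nonzero space, it forces \<open>w\<close> into
  \<open>\<pi>\<close>.\<close>

lemma whittaker_model_unique:
  assumes "irreducible_rep G \<pi>" "subrep G \<pi> V" "subrep G W GG" "rep_iso G \<pi> W"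
  shows "\<pi> = wspan" and "W = wavg ` wspan"
proof -
  from assms(4) obtain \<phi> where bij: "bij_betw \<phi> \<pi> W"
    and add: "\<forall>f\<in>\<pi>. \<forall>g\<in>\<pi>. \<phi> (f + g) = \<phi> f + \<phi> g"
    and scale: "\<forall>c. \<forall>f\<in>\<pi>. \<phi> (fscale c f) = fscale c (\<phi> f)"
    and rtr: "\<forall>h\<in>carrier G. \<forall>f\<in>\<pi>. \<phi> (rtrans G h f) = rtrans G h (\<phi> f)"
    by (auto simp: rep_iso_def)
  have \<pi>: "cfun.subspace \<pi>" "\<And>f h. f \<in> \<pi> \<Longrightarrow> h \<in> carrier G \<Longrightarrow> rtrans G h f \<in> \<pi>" "\<pi> \<subseteq> V"
    using assms(2) by (auto simp: subrep_def)
  have W: "W \<subseteq> GG" "cfun.subspace W" using assms(3) by (auto simp: subrep_def)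
  have key: "\<phi> f g = \<phi> (fscale (wavg f g) w) \<one>" if f: "f \<in> \<pi>" and g: "g \<in> carrier G" for f g
  proof -
    have "\<phi> f \<in> GG" using bij f W by (auto simp: bij_betw_def)
    then have "wavg (\<phi> f) g = (\<Sum>u\<in>U. cnj (\<theta> u) * (\<theta> u * \<phi> f g)) / of_nat (card U)"
      using g by (simp add: wavg_def induced_rep_def)
    also have "\<dots> = \<phi> f g"
      using \<theta>_cnj card_U by (simp add: mult.assoc[symmetric])
    finally have "\<phi> f g = wproj (\<phi> (rtrans G g f)) \<one>"
      using wproj_rtrans_one[OF g, of "\<phi> f"] rtr f g by simp
    also have "wproj (\<phi> (rtrans G g f)) = \<phi> (wproj (rtrans G g f))"
      using hom_wproj[OF \<pi>(1,2) add scale rtr, of "rtrans G g f"] \<pi>(2)[OF f g] by simp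
    finally show ?thesis using wproj_rtrans[OF _ g, of f] f \<pi>(3) by auto
  qed
  have zero: "\<phi> 0 = 0"
    using scale \<pi>(1) by (metis cfun.scale_zero_left cfun.subspace_0)
  have "\<pi> \<noteq> {0}" using assms(1) by (simp add: irreducible_rep_def)
  then obtain f0 where f0: "f0 \<in> \<pi>" "f0 \<noteq> 0"
    using cfun.subspace_0[OF \<pi>(1)] by auto
  have "\<phi> f0 \<noteq> 0"
    using f0 zero bij cfun.subspace_0[OF \<pi>(1)] by (metis bij_betw_imp_inj_on inj_onD)
  moreover have "\<phi> f0 \<in> group_functions G"
    using bij f0 W by (auto simp: bij_betw_def induced_rep_def)
  ultimately obtain g where g: "g \<in> carrier G" "\<phi> f0 g \<noteq> 0"
    by (auto simp: group_functions_def fun_eq_iff)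
  have "wavg f0 g \<noteq> 0"
    using key[OF f0(1) g(1)] g(2) zero by auto
  then have w\<pi>: "w \<in> \<pi>" using w_in_subrep[OF assms(2) f0(1) g(1)] by simp
  have "subrep G wspan \<pi>"
    using wspan_minimal[OF assms(2) w\<pi>] subrep_wspan by (auto simp: subrep_def)
  moreover have "wspan \<noteq> {0}"
    using irreducible_wspan by (auto simp: irreducible_rep_def)
  ultimately show eq: "\<pi> = wspan" using assms(1) by (auto simp: irreducible_rep_def)
  \<comment> \<open>The scalar by which \<open>\<phi>\<close> differs from \<open>wavg\<close>,
    because \<open>wavg w \<one> = 1\<close>.\<close>
  define c where "c = \<phi> w \<one>"
  have phi: "\<phi> f = fscale c (wavg f)" if "f \<in> \<pi>" for f
  proof
    fix x
    have "\<phi> f \<in> group_functions G"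
      using bij that W by (auto simp: bij_betw_def induced_rep_def)
    then show "\<phi> f x = fscale c (wavg f) x"
      using key[OF that, of x] scale[rule_format, OF w\<pi>, of "wavg f x"]
      by (cases "x \<in> carrier G") (auto simp: fscale_def c_def group_functions_def wavg_def)
  qed
  have "c \<noteq> 0" using phi[OF f0(1)] \<open>\<phi> f0 \<noteq> 0\<close> by auto
  have "W = \<phi> ` wspan" using bij eq by (simp add: bij_betw_def)
  also have "\<dots> = (\<lambda>f. wavg (fscale c f)) ` wspan"
    using phi eq by (intro image_cong) (auto simp: wavg_scale)
  also have "\<dots> = wavg ` (fscale c ` wspan)" by (simp add: image_image)
  also have "fscale c ` wspan = wspan"
  proof -
    have s: "fscale d f \<in> wspan" if "f \<in> wspan" for d f
      using that by (simp add: wspan_def cfun.span_scale)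
    then show ?thesis
      using \<open>c \<noteq> 0\<close> by (auto intro!: rev_image_eqI[OF s[of _ "1 / c"]])
  qed
  finally show "W = wavg ` wspan" .
qed

text \<open>Ensures that \<open>SOME\<close> in \<open>generic_constituent\<close> picks an actual
  constituent.\<close>

lemma constituent_exists:
  "\<exists>\<pi>. subrep G \<pi> V \<and> irreducible_rep G \<pi> \<and> (\<exists>W. subrep G W GG \<and> rep_iso G \<pi> W)"
  using subrep_wspan irreducible_wspan subrep_wavg_image rep_iso_wavg by blast

lemma whittaker_model_eq:
  assumes "irreducible_rep G \<pi>" "subrep G \<pi> V" "\<exists>W. subrep G W GG \<and> rep_iso G \<pi> W"
  shows "(THE W. subrep G W GG \<and> rep_iso G \<pi> W) = wavg ` wspan"
  using assms whittaker_model_unique(2)[OF assms(1,2)] by (intro the_equality) blast+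

text \<open>Right equivariance of \<open>wavg f\<close> is pulled back along the injective
  intertwiner: \<open>f\<close> itself is a Whittaker vector, hence a multiple of \<open>w\<close>,
  and the normalisation at \<one> fixes the multiple.\<close>

lemma bessel_eq:
  "(THE J. J \<in> wavg ` wspan \<and> J \<one> = 1 \<and>
      (\<forall>u\<in>U. \<forall>v\<in>U. \<forall>g\<in>carrier G. J (u \<otimes> g \<otimes> v) = \<theta> (u \<otimes> v) * J g)) = wavg w"
proof (rule the_equality, intro conjI ballI)
  show "wavg w \<in> wavg ` wspan" using w_in_wspan by simp
  show "wavg w \<one> = 1" by (rule wavg_w_one)
  fix u v g assume *: "u \<in> U" "v \<in> U" "g \<in> carrier G"
  have "rtrans G v w = fscale (\<theta> v) w"
    using w_right * w_in by (auto simp: rtrans_def fscale_def fun_eq_iff induced_rep_def group_functions_def)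
  then have "rtrans G v (wavg w) = fscale (\<theta> v) (wavg w)"
    using wavg_rtrans[of v w] * by (simp add: wavg_scale U_carrier)
  then have "wavg w (u \<otimes> g \<otimes> v) = \<theta> v * wavg w (u \<otimes> g)"
    using * by (auto simp: rtrans_def fscale_def fun_eq_iff U_carrier split: if_splits dest: spec[of _ "u \<otimes> g"])
  then show "wavg w (u \<otimes> g \<otimes> v) = \<theta> (u \<otimes> v) * wavg w g"
    using * by (simp add: wavg_equivariant \<theta>_mult)
next
  fix J assume J: "J \<in> wavg ` wspan \<and> J \<one> = 1 \<and>
      (\<forall>u\<in>U. \<forall>v\<in>U. \<forall>g\<in>carrier G. J (u \<otimes> g \<otimes> v) = \<theta> (u \<otimes> v) * J g)"
  then obtain f where f: "f \<in> wspan" "J = wavg f" by auto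
  have fV: "f \<in> V" using f subrep_wspan by (auto simp: subrep_def)
  have one: "\<one> \<in> U" using subgroup_U by (simp add: subgroup.one_closed)
  have rt: "rtrans G v f = fscale (\<theta> v) f" if v: "v \<in> U" for v
  proof -
    have "J (g \<otimes> v) = \<theta> v * J g" if "g \<in> carrier G" for g
      using J one v that by (metis U_carrier l_one)
    then have "rtrans G v (wavg f) = fscale (\<theta> v) (wavg f)"
      using f wavg_in_GG[of f]
      by (auto simp: rtrans_def fscale_def fun_eq_iff induced_rep_def group_functions_def)
    then have "wavg (rtrans G v f) = wavg (fscale (\<theta> v) f)"
      using v by (simp add: wavg_rtrans wavg_scale U_carrier)
    moreover have "rtrans G v f \<in> wspan" "fscale (\<theta> v) f \<in> wspan"
      using f(1) v subrep_wspan by (auto simp: subrep_def U_carrier cfun.subspace_scale)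
    ultimately show ?thesis using inj_on_wavg by (auto dest: inj_onD)
  qed
  have "f = fscale (f \<one>) w"
  proof (rule w_unique[OF fV])
    fix g u assume "g \<in> carrier G" "u \<in> U"
    then show "f (g \<otimes> u) = \<theta> u * f g"
      using fun_cong[OF rt[of u], of g] by (simp add: rtrans_def fscale_def)
  qed
  then have Jc: "J = fscale (f \<one>) (wavg w)" using f wavg_scale by metis
  then have "f \<one> = 1" using J wavg_w_one by (simp add: fscale_def)
  then show "J = wavg w" using Jc by (simp add: fscale_def)
qed

end

subsection \<open>Triangular subgroups of the general linear group\<close>

lemma mult_GL: "mult (GL n) = (*)"
  by (simp add: GL_def units_of_mult ring_mat_simps)

lemma one_GL: "one (GL n) = 1\<^sub>m n"
  by (simp add: GL_def units_of_one ring_mat_simps)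

lemmas GL_simps = mult_GL one_GL

lemma carrier_GL_iff: "A \<in> carrier (GL n) \<longleftrightarrow> A \<in> carrier_mat n n \<and> det A \<noteq> 0"
  unfolding GL_def units_of_carrier
  using det_non_zero_imp_unit[of A n "()"] unit_imp_det_non_zero[of A n "()"]
  by (auto simp: Units_def ring_mat_simps)

lemma GL_carrier_mat: "A \<in> carrier (GL n) \<Longrightarrow> A \<in> carrier_mat n n"
  by (simp add: carrier_GL_iff)

lemma group_GL: "group (GL n)"
proof -
  interpret ring "ring_mat TYPE('a) n ()" by (rule ring_mat)
  show ?thesis unfolding GL_def by (rule units_group)
qed

lemma finite_carrier_mat: "finite (carrier_mat m n :: 'a :: finite mat set)"
proof -
  have "carrier_mat m n \<subseteq> (\<lambda>f. mat m n f) ` ({..<m} \<times> {..<n} \<rightarrow>\<^sub>E (UNIV :: 'a set))"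
  proof
    fix A :: "'a mat" assume "A \<in> carrier_mat m n"
    then have "A = mat m n (restrict (\<lambda>ij. A $$ ij) ({..<m} \<times> {..<n}))"
      by (intro eq_matI) auto
    then show "A \<in> (\<lambda>f. mat m n f) ` ({..<m} \<times> {..<n} \<rightarrow>\<^sub>E (UNIV :: 'a set))"
      by (rule image_eqI[where x = "restrict (\<lambda>ij. A $$ ij) ({..<m} \<times> {..<n})"]) simp
  qed
  then show ?thesis by (rule finite_subset) (simp add: finite_PiE)
qed

lemma finite_GL: "finite (carrier (GL n) :: 'a :: {finite, field} mat set)"
  by (rule finite_subset[OF _ finite_carrier_mat]) (auto dest: GL_carrier_mat)

lemma index_mult_mat_sum:
  assumes "A \<in> carrier_mat l m" "B \<in> carrier_mat m n" "i < l" "j < n"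
  shows "(A * B) $$ (i, j) = (\<Sum>k<m. A $$ (i, k) * B $$ (k, j))"
  using assms by (auto simp: scalar_prod_def atLeast0LessThan)

text \<open>Left multiplication by an element of \<open>H\<close> is injective on a finite set,
  hence onto, which yields the identity and the inverses. Inverses of triangular matrices thus need
  no computation.\<close>

lemma (in group) finite_closed_subgroup:
  assumes sub: "H \<subseteq> carrier G" and fin: "finite H" and ne: "H \<noteq> {}"
    and cl: "\<And>x y. x \<in> H \<Longrightarrow> y \<in> H \<Longrightarrow> x \<otimes> y \<in> H"
  shows "subgroup H G"
proof
  have surj: "(\<lambda>y. x \<otimes> y) ` H = H" if "x \<in> H" for x
  proof (rule endo_inj_surj[OF fin])
    show "inj_on (\<lambda>y. x \<otimes> y) H"
      using sub that by (auto intro!: inj_onI simp: subset_iff)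
  qed (use cl that in auto)
  obtain x where x: "x \<in> H" using ne by blast
  then obtain y where y: "y \<in> H" "x \<otimes> y = x" using surj[OF x] by (metis imageE)
  then have "y = \<one>" using x sub by (metis l_cancel_one subsetD)
  then show one: "\<one> \<in> H" using y by simp
  show "inv x \<in> H" if x: "x \<in> H" for x
  proof -
    obtain y where y: "y \<in> H" "x \<otimes> y = \<one>" using surj[OF x] one by (metis imageE)
    have "inv x = y" using y x sub by (metis inv_equality inv_comm subsetD)
    then show ?thesis using y by simp
  qed
qed (use sub cl in auto)

text \<open>Only the indices \<open>i\<close> and \<open>i + 1\<close> are allowed by both factors.
  For diagonals equal to 1 the superdiagonal becomes additive, which is why \<open>unip_char\<close>
  is a character.\<close>

lemma upper_triangular_mult_superdiag:
  fixes A B :: "'a :: comm_ring_1 mat"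
  assumes A: "A \<in> carrier_mat n n" "upper_triangular A" and B: "B \<in> carrier_mat n n" "upper_triangular B"
    and i: "i + 1 < n"
  shows "(A * B) $$ (i, i + 1) = A $$ (i, i) * B $$ (i, i + 1) + A $$ (i, i + 1) * B $$ (i + 1, i + 1)"
proof -
  have "(A * B) $$ (i, i + 1) = (\<Sum>k<n. A $$ (i, k) * B $$ (k, i + 1))"
    using A B i by (intro index_mult_mat_sum) auto
  also have "\<dots> = (\<Sum>k\<in>{i, i + 1}. A $$ (i, k) * B $$ (k, i + 1))"
  proof (rule sum.mono_neutral_right)
    show "\<forall>k\<in>{..<n} - {i, i + 1}. A $$ (i, k) * B $$ (k, i + 1) = 0"
    proof
      fix k assume k: "k \<in> {..<n} - {i, i + 1}"
      show "A $$ (i, k) * B $$ (k, i + 1) = 0"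
      proof (cases "k < i")
        case True
        then show ?thesis using A i by (simp add: upper_triangularD)
      next
        case False
        then show ?thesis using B k i by (simp add: upper_triangularD)
      qed
    qed
  qed (use i in auto)
  finally show ?thesis by simp
qed

lemma upper_triangular_mult:
  fixes A B :: "'a :: comm_ring_1 mat"
  assumes A: "A \<in> carrier_mat n n" "upper_triangular A" and B: "B \<in> carrier_mat n n" "upper_triangular B"
  shows "upper_triangular (A * B)"
    and "i < n \<Longrightarrow> (A * B) $$ (i, i) = A $$ (i, i) * B $$ (i, i)"
proof -
  show "upper_triangular (A * B)"
  proof
    fix i j assume ij: "j < i" "i < dim_row (A * B)"
    have "A $$ (i, k) * B $$ (k, j) = 0" if "k < n" for k
    proof (cases "k < i")
      case True
      then show ?thesis using A ij by (simp add: upper_triangularD)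
    next
      case False
      then show ?thesis using B ij that by (simp add: upper_triangularD)
    qed
    then show "(A * B) $$ (i, j) = 0"
      using A B ij by (subst index_mult_mat_sum[of _ n n _ n]) (auto intro: sum.neutral)
  qed
next
  assume i: "i < n"
  have "(A * B) $$ (i, i) = (\<Sum>k<n. A $$ (i, k) * B $$ (k, i))"
    using A B i by (intro index_mult_mat_sum) auto
  also have "\<dots> = (\<Sum>k\<in>{i}. A $$ (i, k) * B $$ (k, i))"
  proof (rule sum.mono_neutral_right)
    show "\<forall>k\<in>{..<n} - {i}. A $$ (i, k) * B $$ (k, i) = 0"
    proof
      fix k assume k: "k \<in> {..<n} - {i}"
      show "A $$ (i, k) * B $$ (k, i) = 0"
      proof (cases "k < i")
        case True
        then show ?thesis using A i by (simp add: upper_triangularD)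
      next
        case False
        then show ?thesis using B k i by (simp add: upper_triangularD)
      qed
    qed
  qed (use i in auto)
  finally show "(A * B) $$ (i, i) = A $$ (i, i) * B $$ (i, i)" by simp
qed

lemma unipotent_grp_iff:
  "A \<in> unipotent_grp n \<longleftrightarrow> A \<in> carrier_mat n n \<and> upper_triangular A \<and> (\<forall>i<n. A $$ (i, i) = 1)"
proof -
  have "det A \<noteq> 0" if "A \<in> carrier_mat n n" "upper_triangular A" "\<forall>i<n. A $$ (i, i) = 1"
    using that by (auto simp: det_upper_triangular[of A n] diag_mat_def prod_list_zero_iff)
  then show ?thesis by (auto simp: unipotent_grp_def carrier_GL_iff)
qed

lemma lower_borel_iff:
  "A \<in> lower_borel n \<longleftrightarrow> A \<in> carrier_mat n n \<and> (\<forall>i j. i < j \<longrightarrow> j < n \<longrightarrow> A $$ (i, j) = 0) \<and>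
     (\<forall>i<n. A $$ (i, i) \<noteq> 0)"
proof -
  have "upper_triangular (transpose_mat A) \<longleftrightarrow> (\<forall>i j. i < j \<longrightarrow> j < n \<longrightarrow> A $$ (i, j) = 0)"
    if "A \<in> carrier_mat n n"
    using that by (auto simp: upper_triangular_def)
  moreover have "det A \<noteq> 0 \<longleftrightarrow> (\<forall>i<n. A $$ (i, i) \<noteq> 0)"
    if "A \<in> carrier_mat n n" "\<forall>i j. i < j \<longrightarrow> j < n \<longrightarrow> A $$ (i, j) = 0"
    using that det_lower_triangular[of n A]
    by (auto simp: diag_mat_def prod_list_zero_iff)
  ultimately show ?thesis unfolding lower_borel_def carrier_GL_iff by blast
qed

lemma unipotent_grp_subset: "unipotent_grp n \<subseteq> carrier (GL n)"
  by (auto simp: unipotent_grp_def)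

lemma lower_borel_subset: "lower_borel n \<subseteq> carrier (GL n)"
  by (auto simp: lower_borel_def)

lemma unipotent_grp_mult:
  "A \<in> unipotent_grp n \<Longrightarrow> B \<in> unipotent_grp n \<Longrightarrow> A * B \<in> unipotent_grp n"
  by (auto simp: unipotent_grp_iff upper_triangular_mult[of A n B])

text \<open>Transposition reverses the factors and reduces to the upper triangular case.\<close>

lemma lower_borel_mult_index:
  assumes "A \<in> lower_borel n" "B \<in> lower_borel n" "i < n"
  shows "(A * B) $$ (i, i) = A $$ (i, i) * B $$ (i, i)"
proof -
  have AB: "A \<in> carrier_mat n n" "B \<in> carrier_mat n n"
    using assms by (auto simp: lower_borel_iff)
  have "(transpose_mat B * transpose_mat A) $$ (i, i) =
      transpose_mat B $$ (i, i) * transpose_mat A $$ (i, i)"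
    using assms AB by (intro upper_triangular_mult(2)[of _ n]) (auto simp: lower_borel_def)
  moreover have "transpose_mat B * transpose_mat A = transpose_mat (A * B)"
    using transpose_mult[OF AB] by simp
  ultimately show ?thesis using AB assms(3) by (simp add: mult.commute)
qed

lemma lower_borel_mult:
  assumes "A \<in> lower_borel n" "B \<in> lower_borel n"
  shows "A * B \<in> lower_borel n"
proof -
  have AB: "A \<in> carrier_mat n n" "B \<in> carrier_mat n n"
    using assms by (auto simp: lower_borel_iff)
  have "upper_triangular (transpose_mat B * transpose_mat A)"
    using assms AB by (intro upper_triangular_mult(1)[of _ n]) (auto simp: lower_borel_def)
  moreover have "A * B \<in> carrier (GL n)"
    using assms AB by (auto simp: lower_borel_def carrier_GL_iff det_mult[OF AB])
  ultimately show ?thesis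
    using transpose_mult[OF AB] by (simp add: lower_borel_def)
qed

lemma one_in_unipotent_grp: "1\<^sub>m n \<in> unipotent_grp n"
  by (simp add: unipotent_grp_iff)

lemma one_in_lower_borel: "1\<^sub>m n \<in> lower_borel n"
  by (simp add: lower_borel_iff)

lemma subgroup_unipotent: "subgroup (unipotent_grp n :: 'a :: {finite, field} mat set) (GL n)"
proof (rule group.finite_closed_subgroup[OF group_GL unipotent_grp_subset])
  show "finite (unipotent_grp n :: 'a mat set)"
    by (rule finite_subset[OF unipotent_grp_subset finite_GL])
  show "unipotent_grp n \<noteq> ({} :: 'a mat set)"
    using one_in_unipotent_grp by blast
qed (simp add: mult_GL unipotent_grp_mult)

lemma subgroup_lower_borel: "subgroup (lower_borel n :: 'a :: {finite, field} mat set) (GL n)"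
proof (rule group.finite_closed_subgroup[OF group_GL lower_borel_subset])
  show "finite (lower_borel n :: 'a mat set)"
    by (rule finite_subset[OF lower_borel_subset finite_GL])
  show "lower_borel n \<noteq> ({} :: 'a mat set)"
    using one_in_lower_borel by blast
qed (simp add: mult_GL lower_borel_mult)

section \<open>Additive and multiplicative characters\<close>

lemma additive_character_zero:
  assumes "additive_character \<psi>"
  shows "\<psi> 0 = 1"
proof -
  have "\<psi> 0 * \<psi> 0 = \<psi> 0" "\<psi> 0 \<noteq> 0"
    using assms unfolding additive_character_def by (metis add_0)+
  then show ?thesis by simp
qed

text \<open>Two multiples of \<open>x\<close> coincide in a finite field, so two powers of
  \<open>\<psi> x\<close> coincide and the value is a root of unity.\<close>

lemma norm_additive_character:
  fixes \<psi> :: "'a :: {finite, field} \<Rightarrow> complex"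
  assumes "additive_character \<psi>"
  shows "norm (\<psi> x) = 1"
proof -
  have pow: "\<psi> (of_nat m * x) = \<psi> x ^ m" for m
    using assms additive_character_zero[OF assms]
    by (induction m) (auto simp: additive_character_def algebra_simps)
  have "\<not> inj (\<lambda>m. of_nat m * x)"
    using finite_imageD[of "\<lambda>m. of_nat m * x" "UNIV :: nat set"] by auto
  then obtain k l where "of_nat k * x = of_nat l * x" "k \<noteq> l"
    by (auto simp: inj_def)
  then obtain k l where kl: "\<psi> x ^ k = \<psi> x ^ l" "k < l"
    using pow by (metis nat_neq_iff)
  then have "\<psi> x ^ k * \<psi> x ^ (l - k) = \<psi> x ^ k * 1"
    unfolding power_add[symmetric] using kl by simp
  moreover have "\<psi> x \<noteq> 0" using assms by (simp add: additive_character_def)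
  ultimately have "\<psi> x ^ (l - k) = 1" by simp
  then show ?thesis using kl(2) power_eq_1_iff by fastforce
qed

lemma cnj_additive_character:
  fixes \<psi> :: "'a :: {finite, field} \<Rightarrow> complex"
  assumes "additive_character \<psi>"
  shows "cnj (\<psi> x) = \<psi> (- x)"
proof -
  have "\<psi> x * \<psi> (- x) = 1"
    using assms additive_character_zero[OF assms] by (metis add.right_inverse additive_character_def)
  moreover have "\<psi> x * cnj (\<psi> x) = 1"
    using complex_norm_square[of "\<psi> x"] norm_additive_character[OF assms] by simp
  ultimately show ?thesis by (metis mult_left_cancel mult_zero_left zero_neq_one)
qed

lemma unip_char_mult:
  assumes "additive_character \<psi>" "u \<in> unipotent_grp n" "v \<in> unipotent_grp n"
  shows "unip_char n \<psi> (u * v) = unip_char n \<psi> u * unip_char n \<psi> v"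
proof -
  have "(u * v) $$ (i, i + 1) = u $$ (i, i + 1) + v $$ (i, i + 1)" if "i < n - 1" for i
    using upper_triangular_mult_superdiag[of u n v i] assms that by (auto simp: unipotent_grp_iff)
  then have "(\<Sum>i<n - 1. (u * v) $$ (i, i + 1)) =
      (\<Sum>i<n - 1. u $$ (i, i + 1)) + (\<Sum>i<n - 1. v $$ (i, i + 1))"
    by (simp add: sum.distrib)
  then show ?thesis using assms(1) by (simp add: unip_char_def additive_character_def)
qed

lemma mult_character_one:
  assumes "mult_character \<chi>"
  shows "\<chi> 1 = 1"
proof -
  have "\<chi> (1 * 1) = \<chi> 1 * \<chi> 1" "\<chi> 1 \<noteq> 0"
    using assms unfolding mult_character_def by (metis one_neq_zero)+
  then show ?thesis by simp
qed

lemma diag_char_mult: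
  assumes "\<And>i. i < n \<Longrightarrow> mult_character (\<chi> i)" "b \<in> lower_borel n" "b' \<in> lower_borel n"
  shows "diag_char n \<chi> (b * b') = diag_char n \<chi> b * diag_char n \<chi> b'"
proof -
  have "\<chi> i ((b * b') $$ (i, i)) = \<chi> i (b $$ (i, i)) * \<chi> i (b' $$ (i, i))" if "i < n" for i
    using assms that by (simp add: lower_borel_mult_index lower_borel_iff mult_character_def)
  then show ?thesis by (simp add: diag_char_def prod.distrib)
qed

lemma diag_char_nonzero:
  assumes "\<And>i. i < n \<Longrightarrow> mult_character (\<chi> i)" "b \<in> lower_borel n"
  shows "diag_char n \<chi> b \<noteq> 0"
  using assms by (auto simp: diag_char_def lower_borel_iff mult_character_def)

lemma lower_borel_unipotent_disjoint:
  fixes A :: "'a :: field mat"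
  assumes "A \<in> lower_borel n" "A \<in> unipotent_grp n"
  shows "A = 1\<^sub>m n"
proof (rule eq_matI)
  fix i j assume "i < dim_row (1\<^sub>m n :: 'a mat)" "j < dim_col (1\<^sub>m n :: 'a mat)"
  then have ij: "i < n" "j < n" by auto
  consider "i < j" | "i = j" | "j < i" by linarith
  then show "A $$ (i, j) = 1\<^sub>m n $$ (i, j)"
  proof cases
    case 1
    then show ?thesis using assms(1) ij by (simp add: lower_borel_iff)
  next
    case 2
    then show ?thesis using assms(2) ij by (simp add: unipotent_grp_iff)
  next
    case 3
    then show ?thesis using assms(2) ij by (auto simp: unipotent_grp_iff upper_triangular_def)
  qed
qed (use assms(1) in \<open>auto simp: lower_borel_iff\<close>)

subsection \<open>Uniqueness of Whittaker vectors by row reduction\<close>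

text \<open>On the left it rebuilds row \<open>k\<close> from all rows; on the right it scales
  column \<open>k\<close> and adds multiples of it to the others. One family thus serves the
  elimination on both sides.\<close>

definition row_mat_at :: "nat \<Rightarrow> nat \<Rightarrow> (nat \<Rightarrow> 'a) \<Rightarrow> 'a :: {zero, one} mat" where
  "row_mat_at n k r = mat n n (\<lambda>(i, j). if i = k then r j else if i = j then 1 else 0)"

lemma row_mat_at_carrier [simp]: "row_mat_at n k r \<in> carrier_mat n n"
  by (simp add: row_mat_at_def)

lemma row_mat_at_mult_left:
  fixes A :: "'a :: comm_ring_1 mat"
  assumes "A \<in> carrier_mat n n" "i < n" "j < n"
  shows "(row_mat_at n k r * A) $$ (i, j) = (if i = k then \<Sum>m<n. r m * A $$ (m, j) else A $$ (i, j))"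
proof -
  have "(row_mat_at n k r * A) $$ (i, j) = (\<Sum>m<n. row_mat_at n k r $$ (i, m) * A $$ (m, j))"
    using assms by (intro index_mult_mat_sum) auto
  also have "\<dots> = (\<Sum>m<n. if i = k then r m * A $$ (m, j) else if m = i then A $$ (m, j) else 0)"
    using assms by (intro sum.cong) (auto simp: row_mat_at_def)
  finally show ?thesis using assms(2) by simp
qed

lemma row_mat_at_mult_right:
  fixes A :: "'a :: comm_ring_1 mat"
  assumes "A \<in> carrier_mat n n" "i < n" "j < n" "k < n"
  shows "(A * row_mat_at n k r) $$ (i, j) = A $$ (i, k) * r j + (if j = k then 0 else A $$ (i, j))"
proof -
  have "(A * row_mat_at n k r) $$ (i, j) = (\<Sum>m<n. A $$ (i, m) * row_mat_at n k r $$ (m, j))"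
    using assms by (intro index_mult_mat_sum) auto
  also have "\<dots> = (\<Sum>m<n. (if m = k then A $$ (i, k) * r j else 0) +
      (if m = j then if j = k then 0 else A $$ (i, j) else 0))"
    using assms by (intro sum.cong) (auto simp: row_mat_at_def)
  finally show ?thesis using assms by (simp add: sum.distrib)
qed

lemma row_mat_at_lower:
  assumes "k < n" "r k \<noteq> 0" "\<And>j. k < j \<Longrightarrow> j < n \<Longrightarrow> r j = 0"
  shows "row_mat_at n k r \<in> lower_borel n"
  using assms by (auto simp: lower_borel_iff row_mat_at_def)

lemma row_mat_at_unipotent:
  assumes "k < n" "r k = 1" "\<And>j. j < k \<Longrightarrow> r j = 0"
  shows "row_mat_at n k r \<in> unipotent_grp n"
  using assms by (auto simp: unipotent_grp_iff row_mat_at_def)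

lemma GL_row_nonzero:
  fixes A :: "'a :: field mat"
  assumes "A \<in> carrier (GL n)" "i < n"
  obtains j where "j < n" "A $$ (i, j) \<noteq> 0"
proof -
  interpret group "GL n :: 'a mat monoid" by (rule group_GL)
  define B where "B = inv\<^bsub>GL n\<^esub> A"
  have B: "B \<in> carrier (GL n)" "A * B = 1\<^sub>m n"
    using assms r_inv[of A] by (simp_all add: B_def GL_simps)
  have "(A * B) $$ (i, i) = (\<Sum>k<n. A $$ (i, k) * B $$ (k, i))"
    using assms B by (intro index_mult_mat_sum) (auto dest: GL_carrier_mat)
  then have "(\<Sum>k<n. A $$ (i, k) * B $$ (k, i)) \<noteq> 0" using B assms by simp
  then obtain j where "j < n" "A $$ (i, j) * B $$ (j, i) \<noteq> 0"
    by (meson lessThan_iff sum.not_neutral_contains_not_neutral)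
  then show ?thesis using that by auto
qed

text \<open>If row \<open>k\<close> of \<open>h\<close> has its only nonzero entry in a column \<open>j > k\<close>, then adding a multiple of
  column \<open>j - 1\<close> to column \<open>j\<close> is the same as multiplying by a lower unipotent matrix on the left,
  and \<open>\<psi>\<close> is nontrivial on these column operations.\<close>

lemma whittaker_vanishing:
  fixes \<psi> :: "'a :: {finite, field} \<Rightarrow> complex"
  assumes \<psi>: "nontrivial_additive_character \<psi>"
    and \<chi>: "\<And>i. i < n \<Longrightarrow> mult_character (\<chi> i)"
    and f: "f \<in> principal_series n \<chi>"
    and fU: "\<And>g u. g \<in> carrier (GL n) \<Longrightarrow> u \<in> unipotent_grp n \<Longrightarrow> f (g * u) = unip_char n \<psi> u * f g"
    and h: "h \<in> carrier (GL n)"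
    and kj: "k < j" "j < n"
    and row_k: "\<And>l. l < n \<Longrightarrow> l \<noteq> j \<Longrightarrow> h $$ (k, l) = 0" "h $$ (k, j) \<noteq> 0"
    and top: "\<And>i. i < k \<Longrightarrow> h $$ (i, j - 1) = 0"
  shows "f h = 0"
proof -
  obtain s where s: "\<psi> s \<noteq> 1" using \<psi> by (auto simp: nontrivial_additive_character_def)
  have \<psi>0: "\<psi> 0 = 1"
    using \<psi> additive_character_zero by (auto simp: nontrivial_additive_character_def)
  have hc: "h \<in> carrier_mat n n" using h by (rule GL_carrier_mat)
  define r where "r = (\<lambda>l. if l = j - 1 then 1 else if l = j then s else 0)"
  define E where "E = row_mat_at n (j - 1) r"
  \<comment> \<open>Right multiplication by \<open>E\<close> adds \<open>s\<close> times column
    \<open>j - 1\<close> to column \<open>j\<close>; left multiplication by \<open>C\<close> adds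
    \<open>v i\<close> times row \<open>k\<close> to row \<open>i\<close>. Row \<open>k\<close>
    lives in column \<open>j\<close> alone, so dividing by \<open>h $$ (k, j)\<close> makes the two
    agree. \<open>C\<close> is lower triangular because \<open>v\<close> vanishes up to row
    \<open>k\<close>: above it by \<open>top\<close>, and at it because row \<open>k\<close> is zero
    in column \<open>j - 1\<close>.\<close>
  define v where "v = (\<lambda>i. s / h $$ (k, j) * h $$ (i, j - 1))"
  define C where "C = mat n n (\<lambda>(i, l). (if i = l then 1 else 0) + (if l = k then v i else 0))"
  have v: "v i = 0" if "i \<le> k" for i
    using that top row_k kj by (cases "i = k") (auto simp: v_def)
  have E: "E \<in> unipotent_grp n"
    unfolding E_def using kj by (intro row_mat_at_unipotent) (auto simp: r_def)
  have C: "C \<in> lower_borel n"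
    using kj v by (auto simp: lower_borel_iff C_def)
  have "h * E = C * h"
  proof (rule eq_matI)
    fix i l assume "i < dim_row (C * h)" "l < dim_col (C * h)"
    then have il: "i < n" "l < n" using hc by (auto simp: C_def)
    have "(C * h) $$ (i, l) = (\<Sum>m<n. C $$ (i, m) * h $$ (m, l))"
      using hc il by (intro index_mult_mat_sum) (auto simp: C_def)
    also have "\<dots> = (\<Sum>m<n. (if m = i then h $$ (i, l) else 0) + (if m = k then v i * h $$ (k, l) else 0))"
      using il by (intro sum.cong) (auto simp: C_def algebra_simps)
    also have "\<dots> = h $$ (i, l) + v i * h $$ (k, l)"
      using il kj by (simp add: sum.distrib)
    also have "v i * h $$ (k, l) = (if l = j then s * h $$ (i, j - 1) else 0)"
      using row_k il by (auto simp: v_def)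
    finally show "(h * E) $$ (i, l) = (C * h) $$ (i, l)"
      using hc il kj by (auto simp: E_def row_mat_at_mult_right r_def)
  qed (use hc in \<open>auto simp: C_def E_def row_mat_at_def\<close>)
  moreover have "f (h * E) = \<psi> s * f h"
  proof -
    have "(\<Sum>i<n - 1. E $$ (i, i + 1)) = (\<Sum>i<n - 1. if i = j - 1 then s else 0)"
      using kj by (intro sum.cong) (auto simp: E_def row_mat_at_def r_def)
    also have "\<dots> = s" using kj by simp
    finally show ?thesis using fU[OF h E] by (simp add: unip_char_def)
  qed
  moreover have "f (C * h) = f h"
  proof -
    have "C $$ (i, i) = 1" if "i < n" for i using that v by (simp add: C_def)
    then have "diag_char n \<chi> C = 1"
      using mult_character_one[OF \<chi>] by (auto simp: diag_char_def intro!: prod.neutral)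
    then show ?thesis
      using f h C by (simp add: principal_series_def induced_rep_def GL_simps)
  qed
  ultimately have "(\<psi> s - 1) * f h = 0" by (simp add: algebra_simps)
  then show ?thesis using s by simp
qed

text \<open>Gaussian elimination with lower row operations and upper column operations, none of
  which permutes. The condition \<open>f g \<noteq> 0\<close> forces each pivot onto the diagonal: a
  pivot further right would make \<open>f\<close> vanish.\<close>

lemma whittaker_row_reduction:
  fixes \<psi> :: "'a :: {finite, field} \<Rightarrow> complex"
  assumes \<psi>: "nontrivial_additive_character \<psi>"
    and \<chi>: "\<And>i. i < n \<Longrightarrow> mult_character (\<chi> i)"
    and f: "f \<in> principal_series n \<chi>"
    and fU: "\<And>g u. g \<in> carrier (GL n) \<Longrightarrow> u \<in> unipotent_grp n \<Longrightarrow> f (g * u) = unip_char n \<psi> u * f g"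
    and g: "g \<in> carrier (GL n)" and fg: "f g \<noteq> 0"
  shows "k \<le> n \<Longrightarrow> \<exists>b\<in>lower_borel n. \<exists>u\<in>unipotent_grp n.
    \<forall>i<k. \<forall>j<n. (b * g * u) $$ (i, j) = (if i = j then 1 else 0)"
proof (induction k)
  case 0
  then show ?case using one_in_lower_borel one_in_unipotent_grp by blast
next
  case (Suc k)
  interpret group "GL n :: 'a mat monoid" by (rule group_GL)
  have ac: "additive_character \<psi>" using \<psi> by (simp add: nontrivial_additive_character_def)
  from Suc obtain b u where b: "b \<in> lower_borel n" and u: "u \<in> unipotent_grp n"
    and id: "\<And>i j. i < k \<Longrightarrow> j < n \<Longrightarrow> (b * g * u) $$ (i, j) = (if i = j then 1 else 0)"
    by auto
  define h where "h = b * g * u"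
  have k: "k < n" using Suc by simp
  have GLm: "A * B \<in> carrier (GL n)" if "A \<in> carrier (GL n)" "B \<in> carrier (GL n)" for A B :: "'a mat"
    using m_closed[of A B] that by (simp add: GL_simps)
  have bc: "b' \<in> carrier (GL n)" if "b' \<in> lower_borel n" for b' :: "'a mat"
    using that lower_borel_subset by auto
  have uc: "u' \<in> carrier (GL n)" if "u' \<in> unipotent_grp n" for u' :: "'a mat"
    using that unipotent_grp_subset by auto
  have fB: "f (b' * g') = diag_char n \<chi> b' * f g'" if "b' \<in> lower_borel n" "g' \<in> carrier (GL n)" for b' g'
    using f that by (simp add: principal_series_def induced_rep_def GL_simps)
  have h: "h \<in> carrier (GL n)" using b u g by (simp add: h_def GLm bc uc)
  have hc: "h \<in> carrier_mat n n" using h by (rule GL_carrier_mat)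
  \<comment> \<open>The first \<open>k\<close> rows are unit vectors already, so subtracting their
    multiples clears row \<open>k\<close> to the left of the diagonal.\<close>
  define b1 where "b1 = row_mat_at n k (\<lambda>l. if l < k then - h $$ (k, l) else if l = k then 1 else 0)"
  have b1: "b1 \<in> lower_borel n" unfolding b1_def using k by (intro row_mat_at_lower) auto
  define h1 where "h1 = b1 * h"
  have h1: "h1 \<in> carrier (GL n)" using b1 h by (simp add: h1_def GLm bc)
  have h1c: "h1 \<in> carrier_mat n n" using h1 by (rule GL_carrier_mat)
  have h1_top: "h1 $$ (i, j) = (if i = j then 1 else 0)" if "i < k" "j < n" for i j
    using that k hc id by (simp add: h1_def b1_def row_mat_at_mult_left flip: h_def)
  have h1_row: "h1 $$ (k, j) = 0" if "j < k" for j
  proof -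
    have "h1 $$ (k, j) = (\<Sum>m<n. (if m < k then - h $$ (k, m) else if m = k then 1 else 0) * h $$ (m, j))"
      using that k hc by (simp add: h1_def b1_def row_mat_at_mult_left)
    also have "\<dots> = (\<Sum>m<n. (if m = j then - h $$ (k, j) else 0) + (if m = k then h $$ (k, j) else 0))"
      using that k id by (intro sum.cong) (auto simp flip: h_def)
    also have "\<dots> = 0" using that k by (simp add: sum.distrib)
    finally show ?thesis .
  qed
  obtain j where j: "j < n" "h1 $$ (k, j) \<noteq> 0" "\<And>l. l < j \<Longrightarrow> h1 $$ (k, l) = 0"
  proof -
    obtain j0 where "j0 < n" "h1 $$ (k, j0) \<noteq> 0" using GL_row_nonzero[OF h1 k] by blast
    then show ?thesis
      using that[of "LEAST j. h1 $$ (k, j) \<noteq> 0"]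
      by (metis (mono_tags, lifting) LeastI Least_le le_less_trans not_less_Least)
  qed
  have kj: "k \<le> j" using h1_row j by (metis not_le)
  define c where "c = h1 $$ (k, j)"
  \<comment> \<open>Clears row \<open>k\<close> to the right of the pivot. The rows above are zero
    in column \<open>j\<close>, since \<open>k \<le> j\<close>, and stay as they are.\<close>
  define u1 where "u1 = row_mat_at n j (\<lambda>l. if l < j then 0 else if l = j then 1 else - h1 $$ (k, l) / c)"
  have u1: "u1 \<in> unipotent_grp n" unfolding u1_def using j by (intro row_mat_at_unipotent) auto
  define h2 where "h2 = h1 * u1"
  have h2: "h2 \<in> carrier (GL n)" using u1 h1 by (simp add: h2_def GLm uc)
  have h2c: "h2 \<in> carrier_mat n n" using h2 by (rule GL_carrier_mat)
  have h2_top: "h2 $$ (i, l) = (if i = l then 1 else 0)" if "i < k" "l < n" for i l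
    using that k kj j h1c h1_top by (auto simp: h2_def u1_def row_mat_at_mult_right)
  have h2_row: "h2 $$ (k, l) = (if l = j then c else 0)" if "l < n" for l
    using that k j h1c by (auto simp: h2_def u1_def row_mat_at_mult_right c_def)
  \<comment> \<open>Each operation multiplies \<open>f\<close> by a nonzero character value, so
    nonvanishing survives.\<close>
  have "f h2 = unip_char n \<psi> u1 * (diag_char n \<chi> b1 * (unip_char n \<psi> u * (diag_char n \<chi> b * f g)))"
    using fU[OF h1 u1] fB[OF b1 h] fU[OF GLm[OF bc[OF b] g] u] fB[OF b g]
    by (simp add: h2_def h1_def h_def)
  then have "f h2 \<noteq> 0"
    using fg ac diag_char_nonzero[OF \<chi> b] diag_char_nonzero[OF \<chi> b1]
    by (simp add: unip_char_def additive_character_def)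
  have "j = k"
  proof (rule ccontr)
    assume "j \<noteq> k"
    then have "k < j" using kj by simp
    have "f h2 = 0"
    proof (rule whittaker_vanishing[OF \<psi> \<chi> f fU h2 \<open>k < j\<close> j(1)])
      \<comment> \<open>Here \<open>j - 1 \<ge> k\<close>, and the unit rows above row
        \<open>k\<close> vanish in such columns.\<close>
      show "h2 $$ (i, j - 1) = 0" if "i < k" for i
        using that h2_top[of i "j - 1"] \<open>k < j\<close> j by auto
    qed (use h2_row j c_def in auto)
    with \<open>f h2 \<noteq> 0\<close> show False by simp
  qed
  define b2 where "b2 = row_mat_at n k (\<lambda>l. if l = k then 1 / c else 0)"
  have b2: "b2 \<in> lower_borel n" unfolding b2_def using k j by (intro row_mat_at_lower) (auto simp: c_def)
  have "(b2 * h2) $$ (i, l) = (if i = l then 1 else 0)" if "i < Suc k" "l < n" for i l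
  proof (cases "i = k")
    case True
    have "(b2 * h2) $$ (k, l) = (\<Sum>m<n. if m = k then 1 / c * h2 $$ (k, l) else 0)"
      using that k h2c by (simp add: b2_def row_mat_at_mult_left if_distrib[of "\<lambda>x. x * _"] cong: if_cong)
    then show ?thesis using True k j that h2_row \<open>j = k\<close> by (auto simp: c_def)
  next
    case False
    then show ?thesis using that k h2c h2_top by (simp add: b2_def row_mat_at_mult_left)
  qed
  moreover have "b2 * h2 = (b2 * b1 * b) * g * (u * u1)"
  proof -
    have cm: "b \<in> carrier_mat n n" "g \<in> carrier_mat n n" "u \<in> carrier_mat n n"
      "u1 \<in> carrier_mat n n" "b1 \<in> carrier_mat n n" "b2 \<in> carrier_mat n n"
      using b u g u1 b1 b2 bc uc GL_carrier_mat by auto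
    then show ?thesis
      unfolding h2_def h1_def h_def by (simp add: assoc_mult_mat[of _ n n _ n _ n] mult_carrier_mat[of _ n n])
  qed
  moreover have "b2 * b1 * b \<in> lower_borel n" "u * u1 \<in> unipotent_grp n"
    using b b1 b2 u u1 by (auto intro: lower_borel_mult unipotent_grp_mult)
  ultimately show ?case by metis
qed

lemma whittaker_support:
  fixes \<psi> :: "'a :: {finite, field} \<Rightarrow> complex"
  assumes \<psi>: "nontrivial_additive_character \<psi>"
    and \<chi>: "\<And>i. i < n \<Longrightarrow> mult_character (\<chi> i)"
    and f: "f \<in> principal_series n \<chi>"
    and fU: "\<And>g u. g \<in> carrier (GL n) \<Longrightarrow> u \<in> unipotent_grp n \<Longrightarrow> f (g * u) = unip_char n \<psi> u * f g"
    and g: "g \<in> carrier (GL n)" and fg: "f g \<noteq> 0"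
  obtains b u where "b \<in> lower_borel n" "u \<in> unipotent_grp n" "g = b * u"
proof -
  interpret group "GL n :: 'a mat monoid" by (rule group_GL)
  obtain b u where b: "b \<in> lower_borel n" and u: "u \<in> unipotent_grp n"
    and id: "\<And>i j. i < n \<Longrightarrow> j < n \<Longrightarrow> (b * g * u) $$ (i, j) = (if i = j then 1 else 0)"
    using whittaker_row_reduction[OF assms, of n] by auto
  have c: "b \<in> carrier (GL n)" "u \<in> carrier (GL n)"
    using b u lower_borel_subset unipotent_grp_subset by auto
  have "b * g * u = 1\<^sub>m n"
    using c id by (intro eq_matI) (auto dest!: GL_carrier_mat)
  then have "b \<otimes>\<^bsub>GL n\<^esub> (g \<otimes>\<^bsub>GL n\<^esub> u) = \<one>\<^bsub>GL n\<^esub>"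
    using c g m_assoc by (simp add: GL_simps)
  then have "g \<otimes>\<^bsub>GL n\<^esub> u = inv\<^bsub>GL n\<^esub> b"
    using c g by (metis inv_comm inv_equality m_closed)
  then have "g = inv\<^bsub>GL n\<^esub> b \<otimes>\<^bsub>GL n\<^esub> inv\<^bsub>GL n\<^esub> u"
    using c g by (metis inv_solve_right inv_closed)
  then show ?thesis
    using that subgroup.m_inv_closed[OF subgroup_lower_borel b]
      subgroup.m_inv_closed[OF subgroup_unipotent u] by (simp add: GL_simps)
qed

subsection \<open>The Bessel function of the generic constituent\<close>

text \<open>The description is meaningful by \<open>big_cell_unique\<close>; off the big cell the
  value has to be 0 by \<open>whittaker_support\<close>.\<close>

definition whittaker_vec ::
  "nat \<Rightarrow> ('a :: field \<Rightarrow> complex) \<Rightarrow> (nat \<Rightarrow> 'a \<Rightarrow> complex) \<Rightarrow> 'a mat \<Rightarrow> complex" where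
  "whittaker_vec n \<psi> \<chi> g =
     (if \<exists>b\<in>lower_borel n. \<exists>u\<in>unipotent_grp n. g = b * u
      then THE z. \<exists>b\<in>lower_borel n. \<exists>u\<in>unipotent_grp n. g = b * u \<and>
        z = diag_char n \<chi> b * unip_char n \<psi> u
      else 0)"

text \<open>The two factorisations differ by an element that is both lower triangular and upper
  unipotent, hence the identity.\<close>

lemma big_cell_unique:
  fixes b b' u u' :: "'a :: {finite, field} mat"
  assumes "b \<in> lower_borel n" "b' \<in> lower_borel n" "u \<in> unipotent_grp n" "u' \<in> unipotent_grp n"
    and eq: "b * u = b' * u'"
  shows "b = b'" "u = u'"
proof -
  interpret group "GL n :: 'a mat monoid" by (rule group_GL)
  have c: "b \<in> carrier (GL n)" "b' \<in> carrier (GL n)" "u \<in> carrier (GL n)" "u' \<in> carrier (GL n)"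
    using assms lower_borel_subset unipotent_grp_subset by auto
  let ?d = "inv\<^bsub>GL n\<^esub> b' \<otimes>\<^bsub>GL n\<^esub> b"
  have "b \<otimes>\<^bsub>GL n\<^esub> u = b' \<otimes>\<^bsub>GL n\<^esub> u'" using eq by (simp add: GL_simps)
  then have "?d \<otimes>\<^bsub>GL n\<^esub> u = u'"
    using c by (metis inv_closed m_assoc inv_solve_left m_closed)
  then have d: "?d = u' \<otimes>\<^bsub>GL n\<^esub> inv\<^bsub>GL n\<^esub> u"
    using c by (metis inv_solve_right inv_closed m_closed)
  have "?d \<in> lower_borel n"
    using assms subgroup.m_closed[OF subgroup_lower_borel] subgroup.m_inv_closed[OF subgroup_lower_borel]
    by blast
  moreover have "?d \<in> unipotent_grp n"
    unfolding d
    using assms subgroup.m_closed[OF subgroup_unipotent] subgroup.m_inv_closed[OF subgroup_unipotent]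
    by blast
  ultimately have one: "?d = \<one>\<^bsub>GL n\<^esub>"
    using lower_borel_unipotent_disjoint by (simp add: GL_simps)
  then show "u = u'" using \<open>?d \<otimes>\<^bsub>GL n\<^esub> u = u'\<close> c by simp
  show "b = b'" using one c by (metis inv_equality inv_inv inv_closed inv_comm)
qed

lemma whittaker_vec_big_cell:
  fixes b u :: "'a :: {finite, field} mat"
  assumes "b \<in> lower_borel n" "u \<in> unipotent_grp n"
  shows "whittaker_vec n \<psi> \<chi> (b * u) = diag_char n \<chi> b * unip_char n \<psi> u"
proof -
  have "(THE z. \<exists>b'\<in>lower_borel n. \<exists>u'\<in>unipotent_grp n. b * u = b' * u' \<and>
      z = diag_char n \<chi> b' * unip_char n \<psi> u') = diag_char n \<chi> b * unip_char n \<psi> u"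
  proof (rule the_equality)
    show "\<exists>b'\<in>lower_borel n. \<exists>u'\<in>unipotent_grp n. b * u = b' * u' \<and>
        diag_char n \<chi> b * unip_char n \<psi> u = diag_char n \<chi> b' * unip_char n \<psi> u'"
      using assms by blast
  next
    fix z assume "\<exists>b'\<in>lower_borel n. \<exists>u'\<in>unipotent_grp n. b * u = b' * u' \<and>
      z = diag_char n \<chi> b' * unip_char n \<psi> u'"
    then obtain b' u' where *: "b' \<in> lower_borel n" "u' \<in> unipotent_grp n" "b * u = b' * u'"
      "z = diag_char n \<chi> b' * unip_char n \<psi> u'" by blast
    then show "z = diag_char n \<chi> b * unip_char n \<psi> u"
      using big_cell_unique[OF assms(1) *(1) assms(2) *(2,3)] by simp
  qed
  moreover have "\<exists>b'\<in>lower_borel n. \<exists>u'\<in>unipotent_grp n. b * u = b' * u'"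
    using assms by blast
  ultimately show ?thesis unfolding whittaker_vec_def by (simp only: if_True)
qed

lemma whittaker_vec_zero:
  "\<not> (\<exists>b\<in>lower_borel n. \<exists>u\<in>unipotent_grp n. g = b * u) \<Longrightarrow> whittaker_vec n \<psi> \<chi> g = 0"
  unfolding whittaker_vec_def by (simp only: if_False)

text \<open>Equivariance comes from absorbing a factor into \<open>b\<close> or \<open>u\<close>,
  the complement of the big cell being stable under both multiplications. Uniqueness combines the
  support statement with the value at the identity.\<close>

lemma whittaker_setup_GL:
  fixes \<psi> :: "'a :: {finite, field} \<Rightarrow> complex"
  assumes \<psi>: "nontrivial_additive_character \<psi>"
    and \<chi>: "\<And>i. i < n \<Longrightarrow> mult_character (\<chi> i)"
  shows "whittaker_setup (GL n) (unipotent_grp n) (lower_borel n) (unip_char n \<psi>)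
    (diag_char n \<chi>) (whittaker_vec n \<psi> \<chi>)"
proof -
  interpret group "GL n :: 'a mat monoid" by (rule group_GL)
  let ?w = "whittaker_vec n \<psi> \<chi>"
  have ac: "additive_character \<psi>" using \<psi> by (simp add: nontrivial_additive_character_def)
  have bc: "b \<in> carrier (GL n)" if "b \<in> lower_borel n" for b :: "'a mat"
    using that lower_borel_subset by auto
  have uc: "u \<in> carrier (GL n)" if "u \<in> unipotent_grp n" for u :: "'a mat"
    using that unipotent_grp_subset by auto
  have GLm: "A * B \<in> carrier (GL n)" if "A \<in> carrier (GL n)" "B \<in> carrier (GL n)" for A B :: "'a mat"
    using m_closed[of A B] that by (simp add: GL_simps)
  have GLa: "A * B * C = A * (B * C)"
    if "A \<in> carrier (GL n)" "B \<in> carrier (GL n)" "C \<in> carrier (GL n)" for A B C :: "'a mat"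
    using m_assoc[of A B C] that by (simp add: GL_simps)
  have invb: "\<exists>b'\<in>lower_borel n. b' * b = 1\<^sub>m n" if "b \<in> lower_borel n" for b :: "'a mat"
    using subgroup.m_inv_closed[OF subgroup_lower_borel that] l_inv[OF bc[OF that]]
    by (auto simp: GL_simps)
  have invu: "\<exists>u'\<in>unipotent_grp n. u * u' = 1\<^sub>m n" if "u \<in> unipotent_grp n" for u :: "'a mat"
    using subgroup.m_inv_closed[OF subgroup_unipotent that] r_inv[OF uc[OF that]]
    by (auto simp: GL_simps)
  have left: "?w (h * g) = diag_char n \<chi> h * ?w g"
    if h: "h \<in> lower_borel n" and g: "g \<in> carrier (GL n)" for h g
  proof (cases "\<exists>b\<in>lower_borel n. \<exists>u\<in>unipotent_grp n. g = b * u")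
    case True
    then obtain b u where bu: "b \<in> lower_borel n" "u \<in> unipotent_grp n" "g = b * u" by blast
    have "h * g = (h * b) * u" using GLa bu bc uc h by simp
    then have "?w (h * g) = diag_char n \<chi> (h * b) * unip_char n \<psi> u"
      using whittaker_vec_big_cell[OF lower_borel_mult[OF h bu(1)] bu(2)] by simp
    then show ?thesis
      using diag_char_mult[OF \<chi> h bu(1)] bu by (simp add: whittaker_vec_big_cell)
  next
    case False
    have "\<not> (\<exists>b\<in>lower_borel n. \<exists>u\<in>unipotent_grp n. h * g = b * u)"
    proof
      assume "\<exists>b\<in>lower_borel n. \<exists>u\<in>unipotent_grp n. h * g = b * u"
      then obtain b u where bu: "b \<in> lower_borel n" "u \<in> unipotent_grp n" "h * g = b * u" by blast
      obtain h' where h': "h' \<in> lower_borel n" "h' * h = 1\<^sub>m n" using invb[OF h] by blast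
      have "g = h' * h * g" using h' g GL_carrier_mat by fastforce
      also have "\<dots> = (h' * b) * u" using GLa[of h' h g] GLa[of h' b u] h' h g bu bc uc by simp
      finally show False using False lower_borel_mult[OF h'(1) bu(1)] bu(2) by blast
    qed
    then show ?thesis using False by (simp add: whittaker_vec_zero)
  qed
  have right: "?w (g * v) = unip_char n \<psi> v * ?w g"
    if g: "g \<in> carrier (GL n)" and v: "v \<in> unipotent_grp n" for g v
  proof (cases "\<exists>b\<in>lower_borel n. \<exists>u\<in>unipotent_grp n. g = b * u")
    case True
    then obtain b u where bu: "b \<in> lower_borel n" "u \<in> unipotent_grp n" "g = b * u" by blast
    have "g * v = b * (u * v)" using GLa bu bc uc v by simp
    then have "?w (g * v) = diag_char n \<chi> b * unip_char n \<psi> (u * v)"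
      using whittaker_vec_big_cell[OF bu(1) unipotent_grp_mult[OF bu(2) v]] by simp
    then show ?thesis
      using unip_char_mult[OF ac bu(2) v] bu by (simp add: whittaker_vec_big_cell)
  next
    case False
    have "\<not> (\<exists>b\<in>lower_borel n. \<exists>u\<in>unipotent_grp n. g * v = b * u)"
    proof
      assume "\<exists>b\<in>lower_borel n. \<exists>u\<in>unipotent_grp n. g * v = b * u"
      then obtain b u where bu: "b \<in> lower_borel n" "u \<in> unipotent_grp n" "g * v = b * u" by blast
      obtain v' where v': "v' \<in> unipotent_grp n" "v * v' = 1\<^sub>m n" using invu[OF v] by blast
      have "g = g * (v * v')" using v' g GL_carrier_mat by fastforce
      also have "\<dots> = b * (u * v')" using GLa[of g v v'] GLa[of b u v'] v' v g bu bc uc by simp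
      finally show False using False unipotent_grp_mult[OF bu(2) v'(1)] bu(1) by blast
    qed
    then show ?thesis using False by (simp add: whittaker_vec_zero)
  qed
  have one: "?w (1\<^sub>m n) = 1"
  proof -
    have "?w (1\<^sub>m n * 1\<^sub>m n) = diag_char n \<chi> (1\<^sub>m n) * unip_char n \<psi> (1\<^sub>m n)"
      by (intro whittaker_vec_big_cell one_in_lower_borel one_in_unipotent_grp)
    moreover have "unip_char n \<psi> (1\<^sub>m n) = 1"
      using additive_character_zero[OF ac] by (simp add: unip_char_def)
    moreover have "diag_char n \<chi> (1\<^sub>m n) = 1"
      using mult_character_one[OF \<chi>] by (auto simp: diag_char_def intro!: prod.neutral)
    ultimately show ?thesis by simp
  qed
  have V: "?w \<in> induced_rep (GL n) (lower_borel n) (diag_char n \<chi>)"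
  proof -
    have "?w x = 0" if "x \<notin> carrier (GL n)" for x
      using that GLm bc uc by (intro whittaker_vec_zero) blast
    then show ?thesis using left by (simp add: induced_rep_def group_functions_def GL_simps)
  qed
  have uniq: "f = fscale (f (1\<^sub>m n)) ?w"
    if f: "f \<in> induced_rep (GL n) (lower_borel n) (diag_char n \<chi>)"
      and fU: "\<And>g u. g \<in> carrier (GL n) \<Longrightarrow> u \<in> unipotent_grp n \<Longrightarrow> f (g * u) = unip_char n \<psi> u * f g"
    for f
  proof
    fix x
    show "f x = fscale (f (1\<^sub>m n)) ?w x"
    proof (cases "\<exists>b\<in>lower_borel n. \<exists>u\<in>unipotent_grp n. x = b * u")
      case True
      then obtain b u where bu: "b \<in> lower_borel n" "u \<in> unipotent_grp n" "x = b * u" by blast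
      have "f (1\<^sub>m n * u) = unip_char n \<psi> u * f (1\<^sub>m n)"
        using fU[of "1\<^sub>m n" u] bu(2) one_closed by (simp add: GL_simps)
      moreover have "1\<^sub>m n * u = u" using uc[OF bu(2)] GL_carrier_mat by fastforce
      moreover have "f (b * u) = diag_char n \<chi> b * f u"
        using f bu uc by (simp add: induced_rep_def GL_simps)
      ultimately show ?thesis
        using bu whittaker_vec_big_cell[OF bu(1,2)] by (simp add: fscale_def)
    next
      case False
      have "f x = 0"
      proof (rule ccontr)
        assume fx: "f x \<noteq> 0"
        then have "x \<in> carrier (GL n)" using f by (auto simp: induced_rep_def group_functions_def)
        from whittaker_support[OF \<psi> \<chi> _ fU this fx] f False show False
          by (auto simp: principal_series_def)
      qed
      then show ?thesis using False by (simp add: fscale_def whittaker_vec_zero)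
    qed
  qed
  show ?thesis
  proof (rule whittaker_setup.intro[OF group_axioms], rule whittaker_setup_axioms.intro, unfold GL_simps)
    show "cmod (unip_char n \<psi> u) = 1" if "u \<in> unipotent_grp n" for u
      using norm_additive_character[OF ac] by (simp add: unip_char_def)
  qed (use unip_char_mult[OF ac] V right one uniq finite_GL subgroup_unipotent subgroup_lower_borel in blast)+
qed

text \<open>Whichever constituent \<open>SOME\<close> selects, its Whittaker model is the same
  space, so its Bessel function is the average of the explicit vector.\<close>

lemma bessel_generic_constituent:
  fixes \<psi> :: "'a :: {finite, field} \<Rightarrow> complex"
  assumes \<psi>: "nontrivial_additive_character \<psi>"
    and \<chi>: "\<And>i. i < n \<Longrightarrow> mult_character (\<chi> i)"
    and g: "g \<in> carrier (GL n)"
  shows "bessel_function n \<psi> (generic_constituent n \<psi> \<chi>) g =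
    (\<Sum>u\<in>unipotent_grp n. cnj (unip_char n \<psi> u) * whittaker_vec n \<psi> \<chi> (u * g)) /
      of_nat (card (unipotent_grp n :: 'a mat set))"
proof -
  interpret whittaker_setup "GL n" "unipotent_grp n" "lower_borel n" "unip_char n \<psi>"
    "diag_char n \<chi>" "whittaker_vec n \<psi> \<chi>"
    by (rule whittaker_setup_GL[OF \<psi> \<chi>])
  let ?\<pi> = "generic_constituent n \<psi> \<chi>"
  have "\<exists>\<pi>. subrep (GL n) \<pi> (principal_series n \<chi>) \<and> generic_rep n \<psi> \<pi>"
    using constituent_exists by (simp add: principal_series_def generic_rep_def gelfand_graev_def)
  from someI_ex[OF this] have "subrep (GL n) ?\<pi> (principal_series n \<chi>)" "generic_rep n \<psi> ?\<pi>"
    by (simp_all add: generic_constituent_def)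
  then have "whittaker_model n \<psi> ?\<pi> = wavg ` wspan"
    using whittaker_model_eq[of ?\<pi>]
    by (simp add: whittaker_model_def generic_rep_def gelfand_graev_def principal_series_def)
  then have "bessel_function n \<psi> ?\<pi> = wavg (whittaker_vec n \<psi> \<chi>)"
    using bessel_eq by (simp add: bessel_function_def GL_simps)
  then show ?thesis using g by (simp add: wavg_def GL_simps)
qed

subsection \<open>The Bessel function on the two-block element\<close>

text \<open>Entrywise form of the two-block element: right multiplication moves every column one
  place to the right, and the last one, times \<open>a\<close>, to the front.\<close>

definition shift_mat :: "nat \<Rightarrow> 'a \<Rightarrow> 'a :: field mat" where
  "shift_mat n a = mat n n (\<lambda>(i, j). if i = n - 1 then if j = 0 then a else 0
     else if j = i + 1 then 1 else 0)"

definition last_col_mat :: "nat \<Rightarrow> (nat \<Rightarrow> 'a) \<Rightarrow> 'a :: field mat" where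
  "last_col_mat n x = mat n n (\<lambda>(i, j). if i = j then 1 else if j = n - 1 then x i else 0)"

lemma shift_mat_carrier [simp]: "shift_mat n a \<in> carrier_mat n n"
  "dim_row (shift_mat n a) = n" "dim_col (shift_mat n a) = n"
  by (simp_all add: shift_mat_def)

lemma last_col_mat_carrier [simp]: "last_col_mat n x \<in> carrier_mat n n"
  "dim_row (last_col_mat n x) = n" "dim_col (last_col_mat n x) = n"
  by (simp_all add: last_col_mat_def)

lemma anti_block_eq_shift_mat:
  assumes "n \<ge> 2"
  shows "anti_block [(n - 1, 1), (1, a)] = shift_mat n a"
  by (rule eq_matI) (use assms in \<open>auto simp: shift_mat_def Let_def\<close>)

lemma last_col_mat_unipotent: "last_col_mat n x \<in> unipotent_grp n"
  by (auto simp: unipotent_grp_iff last_col_mat_def)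

lemma last_col_mat_mult:
  assumes "A \<in> carrier_mat n n" "i < n" "j < n"
  shows "(last_col_mat n x * A) $$ (i, j) = A $$ (i, j) + (if i < n - 1 then x i * A $$ (n - 1, j) else 0)"
proof -
  have "(last_col_mat n x * A) $$ (i, j) = (\<Sum>k<n. last_col_mat n x $$ (i, k) * A $$ (k, j))"
    using assms by (intro index_mult_mat_sum) auto
  also have "\<dots> = (\<Sum>k<n. (if k = i then A $$ (i, j) else 0) +
      (if k = n - 1 then if i < n - 1 then x i * A $$ (n - 1, j) else 0 else 0))"
    using assms by (intro sum.cong) (auto simp: last_col_mat_def)
  finally show ?thesis using assms by (simp add: sum.distrib)
qed

lemma mult_shift_mat:
  assumes "A \<in> carrier_mat n n" "i < n" "j < n"
  shows "(A * shift_mat n a) $$ (i, j) = (if j = 0 then a * A $$ (i, n - 1) else A $$ (i, j - 1))"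
proof -
  have "(A * shift_mat n a) $$ (i, j) = (\<Sum>k<n. A $$ (i, k) * shift_mat n a $$ (k, j))"
    using assms by (intro index_mult_mat_sum) auto
  also have "\<dots> = (\<Sum>k<n. if k = (if j = 0 then n - 1 else j - 1)
      then if j = 0 then a * A $$ (i, n - 1) else A $$ (i, j - 1) else 0)"
    using assms by (intro sum.cong) (auto simp: shift_mat_def)
  finally show ?thesis using assms by simp
qed

lemma shift_mat_mult:
  assumes "A \<in> carrier_mat n n" "i < n" "j < n"
  shows "(shift_mat n a * A) $$ (i, j) = (if i = n - 1 then a * A $$ (0, j) else A $$ (i + 1, j))"
proof -
  have "(shift_mat n a * A) $$ (i, j) = (\<Sum>k<n. shift_mat n a $$ (i, k) * A $$ (k, j))"
    using assms by (intro index_mult_mat_sum) auto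
  also have "\<dots> = (\<Sum>k<n. if k = (if i = n - 1 then 0 else i + 1)
      then if i = n - 1 then a * A $$ (0, j) else A $$ (i + 1, j) else 0)"
    using assms by (intro sum.cong) (auto simp: shift_mat_def)
  finally show ?thesis using assms by auto
qed

text \<open>The sequence \<open>-1, y\<^sub>1, \<dots>, y\<^sub>n\<^sub>-\<^sub>1, a\<close>: with \<open>-1\<close> in front, the first and last entries of
  \<open>torus_param\<close> obey the same formula as the others.\<close>

definition gt_node :: "nat \<Rightarrow> 'a :: field \<Rightarrow> (nat \<Rightarrow> 'a) \<Rightarrow> nat \<Rightarrow> 'a" where
  "gt_node n a y k = (if k = 0 then -1 else if k = n then a else y k)"

lemma gt_node_nonzero:
  "a \<noteq> 0 \<Longrightarrow> y \<in> {1..n - 1} \<rightarrow>\<^sub>E {x. x \<noteq> 0} \<Longrightarrow> k \<le> n \<Longrightarrow> gt_node n a y k \<noteq> 0"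
  by (auto simp: gt_node_def PiE_iff)

lemma torus_param_eq:
  "n \<ge> 2 \<Longrightarrow> torus_param n a y = mat_diag n (\<lambda>i. - (gt_node n a y (i + 1) / gt_node n a y i))"
  by (rule eq_matI) (auto simp: torus_param_def mat_diag_def gt_node_def)

text \<open>On and below the diagonal the entries of \<open>b\<close> depend on the column only
  through \<open>1 / z j\<close>. Hence for \<open>j \<ge> 1\<close>, column \<open>j\<close> minus
  \<open>z (j - 1) / z j\<close> times column \<open>j - 1\<close> cancels there and leaves a 1 just
  above the diagonal; column 0 is untouched and equals \<open>z (i + 1)\<close> as
  \<open>z 0 = -1\<close>.\<close>

lemma last_col_shift_decomposition:
  fixes a :: "'a :: field"
  assumes n: "n \<ge> 2" and z: "\<And>k. k \<le> n \<Longrightarrow> z k \<noteq> 0" and z0: "z 0 = -1" and zn: "z n = a"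
    and b_def: "b = mat n n (\<lambda>(i, j). if j \<le> i then - (z (i + 1) / z j) else 0)"
    and v_def: "v = mat n n (\<lambda>(i, j). if i = j then 1 else if j = i + 1 then - (z i / z j) else 0)"
  shows "last_col_mat n (\<lambda>i. z (i + 1) / a) * shift_mat n a = b * v"
    and "b \<in> lower_borel n" and "v \<in> unipotent_grp n"
proof -
  show "b \<in> lower_borel n" using z by (auto simp: b_def lower_borel_iff)
  show "v \<in> unipotent_grp n" by (auto simp: v_def unipotent_grp_iff)
  show "last_col_mat n (\<lambda>i. z (i + 1) / a) * shift_mat n a = b * v"
  proof (rule eq_matI)
    fix i j assume "i < dim_row (b * v)" "j < dim_col (b * v)"
    then have ij: "i < n" "j < n" by (auto simp: b_def v_def)
    have "(b * v) $$ (i, j) = (\<Sum>k<n. b $$ (i, k) * v $$ (k, j))"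
      using ij by (intro index_mult_mat_sum) (auto simp: b_def v_def)
    also have "\<dots> = (\<Sum>k<n. (if k = j then b $$ (i, j) else 0) +
        (if k = j - 1 then if j = 0 then 0 else - (b $$ (i, j - 1) * (z (j - 1) / z j)) else 0))"
      using ij by (intro sum.cong) (auto simp: v_def)
    also have "\<dots> = b $$ (i, j) + (if j = 0 then 0 else - (b $$ (i, j - 1) * (z (j - 1) / z j)))"
      using ij by (simp add: sum.distrib)
    also have "\<dots> = (if j = 0 then z (i + 1) else if i = j - 1 then 1 else 0)"
      using ij z[of "j - 1"] z[of j] z0 by (auto simp: b_def)
    also have "\<dots> = (last_col_mat n (\<lambda>i. z (i + 1) / a) * shift_mat n a) $$ (i, j)"
      using ij n z[of n] zn by (auto simp: mult_shift_mat last_col_mat_def simp del: index_mult_mat(1))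
    finally show "(last_col_mat n (\<lambda>i. z (i + 1) / a) * shift_mat n a) $$ (i, j) = (b * v) $$ (i, j)"
      by simp
  qed (auto simp: b_def v_def last_col_mat_def shift_mat_def)
qed

text \<open>Invertibility is read off from the factorisation with all inner nodes equal to 1, where
  both triangular factors have nonzero determinant.\<close>

lemma shift_mat_GL:
  fixes a :: "'a :: field"
  assumes "n \<ge> 2" "a \<noteq> 0"
  shows "shift_mat n a \<in> carrier (GL n)"
proof -
  define z where "z = gt_node n a (\<lambda>_. 1)"
  have z: "\<And>k. k \<le> n \<Longrightarrow> z k \<noteq> 0" "z 0 = -1" "z n = a"
    using assms by (auto simp: z_def gt_node_def)
  obtain b v where *: "last_col_mat n (\<lambda>i. z (i + 1) / a) * shift_mat n a = b * v"
    "b \<in> lower_borel n" "v \<in> unipotent_grp n"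
    using last_col_shift_decomposition[OF assms(1) z refl refl] by blast
  then have bv: "b \<in> carrier_mat n n" "v \<in> carrier_mat n n" "det b \<noteq> 0" "det v \<noteq> 0"
    using lower_borel_subset unipotent_grp_subset by (auto simp: carrier_GL_iff subset_iff)
  have "det (last_col_mat n (\<lambda>i. z (i + 1) / a)) * det (shift_mat n a) = det b * det v"
    using arg_cong[OF *(1), of det] bv by (simp add: det_mult[of _ n])
  then show ?thesis using bv by (auto simp: carrier_GL_iff)
qed

text \<open>When \<open>x k = 0\<close>, row \<open>k\<close> of the product vanishes in columns 0
  to \<open>k\<close>. Multiplying by the inverse of \<open>u\<close>, which is upper triangular,
  would then give \<open>b $$ (k, k) = 0\<close>.\<close>

lemma whittaker_vec_last_col_zero:
  fixes a :: "'a :: {finite, field}"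
  assumes k: "k < n - 1" and x: "x k = 0"
  shows "whittaker_vec n \<psi> \<chi> (last_col_mat n x * shift_mat n a) = 0"
proof (rule whittaker_vec_zero, rule notI)
  interpret group "GL n :: 'a mat monoid" by (rule group_GL)
  let ?M = "last_col_mat n x * shift_mat n a"
  assume "\<exists>b\<in>lower_borel n. \<exists>u\<in>unipotent_grp n. ?M = b * u"
  then obtain b u where b: "b \<in> lower_borel n" and u: "u \<in> unipotent_grp n" and M: "?M = b * u"
    by blast
  define u' where "u' = inv\<^bsub>GL n\<^esub> u"
  have u': "u' \<in> unipotent_grp n"
    unfolding u'_def using subgroup.m_inv_closed[OF subgroup_unipotent u] by simp
  have c: "b \<in> carrier (GL n)" "u \<in> carrier (GL n)"
    using b u lower_borel_subset unipotent_grp_subset by auto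
  have "b * u * u' = b"
    using m_assoc[of b u u'] r_inv[of u] c GL_carrier_mat[of b n] by (simp add: u'_def GL_simps)
  then have bM: "b = ?M * u'" using M by simp
  have Mc: "?M \<in> carrier_mat n n" by (rule mult_carrier_mat[of _ n n]) simp_all
  have "b $$ (k, k) = (\<Sum>m<n. ?M $$ (k, m) * u' $$ (m, k))"
    unfolding bM using k u' by (intro index_mult_mat_sum[OF Mc, of _ n]) (auto simp: unipotent_grp_iff)
  also have "\<dots> = 0"
  proof (rule sum.neutral, rule ballI)
    fix m assume m: "m \<in> {..<n}"
    show "?M $$ (k, m) * u' $$ (m, k) = 0"
    proof (cases "m \<le> k")
      case True
      then show ?thesis using k x m by (auto simp: mult_shift_mat last_col_mat_def simp del: index_mult_mat(1))
    next
      case False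
      then show ?thesis using u' m k by (auto simp: unipotent_grp_iff upper_triangular_def)
    qed
  qed
  finally show False using b k by (simp add: lower_borel_iff)
qed

text \<open>What remains of a summand of the Bessel average: a function of the last column alone.
  Counting from 0, \<open>n - 2\<close> is the row of the superdiagonal entry in that
  column.\<close>

definition col_term ::
  "nat \<Rightarrow> ('a :: field \<Rightarrow> complex) \<Rightarrow> (nat \<Rightarrow> 'a \<Rightarrow> complex) \<Rightarrow> 'a \<Rightarrow> (nat \<Rightarrow> 'a) \<Rightarrow> complex" where
  "col_term n \<psi> \<chi> a x = cnj (\<psi> (x (n - 2))) * whittaker_vec n \<psi> \<chi> (last_col_mat n x * shift_mat n a)"

text \<open>Allows columns to be restricted to the free rows, as summation over
  \<open>\<rightarrow>\<^sub>E\<close> requires.\<close>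

lemma last_col_mat_cong: "(\<And>i. i < n - 1 \<Longrightarrow> x i = x' i) \<Longrightarrow> last_col_mat n x = last_col_mat n x'"
  by (rule eq_matI) (auto simp: last_col_mat_def)

lemma col_term_cong:
  assumes "n \<ge> 2" "\<And>i. i < n - 1 \<Longrightarrow> x i = x' i"
  shows "col_term n \<psi> \<chi> a x = col_term n \<psi> \<chi> a x'"
  using assms last_col_mat_cong[of n x x'] by (simp add: col_term_def)

lemma col_term_zero:
  fixes a :: "'a :: {finite, field}"
  shows "k < n - 1 \<Longrightarrow> x k = 0 \<Longrightarrow> col_term n \<psi> \<chi> a x = 0"
  by (simp add: col_term_def whittaker_vec_last_col_zero)

text \<open>Writing \<open>u\<close> as (last column) times (block matrix of \<open>u'\<close> and 1), the second factor can be
  moved across \<open>shift_mat\<close>, where its character cancels against that in the average.\<close>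

lemma averaged_term_eq_col_term:
  fixes \<psi> :: "'a :: {finite, field} \<Rightarrow> complex"
  assumes \<psi>: "nontrivial_additive_character \<psi>"
    and \<chi>: "\<And>i. i < n \<Longrightarrow> mult_character (\<chi> i)"
    and n: "n \<ge> 2" and a: "a \<noteq> 0" and u: "u \<in> unipotent_grp n"
  shows "cnj (unip_char n \<psi> u) * whittaker_vec n \<psi> \<chi> (u * shift_mat n a) =
    col_term n \<psi> \<chi> a (\<lambda>i. u $$ (i, n - 1))"
proof -
  interpret whittaker_setup "GL n" "unipotent_grp n" "lower_borel n" "unip_char n \<psi>"
    "diag_char n \<chi>" "whittaker_vec n \<psi> \<chi>"
    by (rule whittaker_setup_GL[OF \<psi> \<chi>])
  have ac: "additive_character \<psi>" using \<psi> by (simp add: nontrivial_additive_character_def)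
  have uc: "u \<in> carrier_mat n n" "upper_triangular u" "\<And>i. i < n \<Longrightarrow> u $$ (i, i) = 1"
    using u by (auto simp: unipotent_grp_iff)
  have u0: "u $$ (i, j) = 0" if "j < i" "i < n" for i j
    using that uc by (auto simp: upper_triangular_def)
  let ?N = "last_col_mat n (\<lambda>i. u $$ (i, n - 1))"
  define d where "d = mat n n (\<lambda>(i, j). if j = n - 1 \<and> i \<noteq> n - 1 then 0 else u $$ (i, j))"
  define d' where "d' = mat n n (\<lambda>(i, j). if i = 0 then if j = 0 then 1 else 0 else if j = 0 then 0
    else u $$ (i - 1, j - 1))"
  have d: "d \<in> carrier_mat n n" by (simp add: d_def)
  have d': "d' \<in> unipotent_grp n"
    using uc u0 by (auto simp: unipotent_grp_iff d'_def upper_triangular_def)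
  have u_eq: "u = ?N * d"
  proof (rule eq_matI)
    fix i j assume "i < dim_row (?N * d)" "j < dim_col (?N * d)"
    then have ij: "i < n" "j < n" using d by auto
    then show "u $$ (i, j) = (?N * d) $$ (i, j)"
      unfolding last_col_mat_mult[OF d ij] using uc(3) u0 by (auto simp: d_def)
  qed (use uc d in auto)
  have d_eq: "d * shift_mat n a = shift_mat n a * d'"
  proof (rule eq_matI)
    have d'c: "d' \<in> carrier_mat n n" by (simp add: d'_def)
    fix i j assume "i < dim_row (shift_mat n a * d')" "j < dim_col (shift_mat n a * d')"
    then have ij: "i < n" "j < n" using d'c by auto
    then show "(d * shift_mat n a) $$ (i, j) = (shift_mat n a * d') $$ (i, j)"
      unfolding mult_shift_mat[OF d ij] shift_mat_mult[OF d'c ij]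
      using uc(3) u0 n by (auto simp: d_def d'_def)
  qed (use d d' in \<open>auto simp: unipotent_grp_iff\<close>)
  have "u * shift_mat n a = ?N * d * shift_mat n a"
    by (rule arg_cong[OF u_eq, of "\<lambda>A. A * shift_mat n a"])
  also have "\<dots> = ?N * (d * shift_mat n a)"
    by (rule assoc_mult_mat[of _ n n _ n _ n]) (simp_all add: d)
  also have "\<dots> = ?N * shift_mat n a * d'"
    unfolding d_eq
    by (rule assoc_mult_mat[of _ n n _ n _ n, symmetric]) (use d' in \<open>simp_all add: unipotent_grp_iff\<close>)
  finally have "u * shift_mat n a = ?N * shift_mat n a * d'" .
  moreover have "?N * shift_mat n a \<in> carrier (GL n)"
    using m_closed[of ?N "shift_mat n a"] shift_mat_GL[OF n a] last_col_mat_unipotent unipotent_grp_subset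
    by (auto simp: GL_simps)
  ultimately have 1: "whittaker_vec n \<psi> \<chi> (u * shift_mat n a) =
      unip_char n \<psi> d' * whittaker_vec n \<psi> \<chi> (?N * shift_mat n a)"
    using w_right[OF _ d'] by (simp add: GL_simps)
  have n1: "n - 1 = Suc (n - 2)" using n by simp
  \<comment> \<open>\<open>d'\<close> is zero at (0, 1), so its superdiagonal is that of
    \<open>u\<close> shifted by one place and lacks just \<open>u $$ (n - 2, n - 1)\<close>, the
    argument of \<psi> retained in \<open>col_term\<close>.\<close>
  have "(\<Sum>i<n - 1. d' $$ (i, i + 1)) = (\<Sum>i<n - 2. u $$ (i, i + 1))"
    unfolding n1 sum.lessThan_Suc_shift using n by (simp add: d'_def)
  moreover have "(\<Sum>i<n - 1. u $$ (i, i + 1)) = (\<Sum>i<n - 2. u $$ (i, i + 1)) + u $$ (n - 2, n - 1)"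
    unfolding n1 by simp
  ultimately have 2: "unip_char n \<psi> u = unip_char n \<psi> d' * \<psi> (u $$ (n - 2, n - 1))"
    using ac by (simp add: unip_char_def additive_character_def)
  have "cnj (unip_char n \<psi> u) * whittaker_vec n \<psi> \<chi> (u * shift_mat n a) =
      (cnj (unip_char n \<psi> d') * unip_char n \<psi> d') * col_term n \<psi> \<chi> a (\<lambda>i. u $$ (i, n - 1))"
    unfolding 1 2 col_term_def complex_cnj_mult by (simp only: mult_ac)
  then show ?thesis unfolding \<theta>_cnj[OF d'] by simp
qed

text \<open>The sum over \<open>U\<close> is averaged once more over left translates by column
  matrices. For fixed \<open>u\<close> the last column of \<open>last_col_mat n x * u\<close> runs
  through all columns exactly once, so the inner sum does not depend on \<open>u\<close>. This
  produces the power of q without coordinates on \<open>U\<close>.\<close>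

lemma bessel_shift_mat_col_sum:
  fixes \<psi> :: "'a :: {finite, field} \<Rightarrow> complex"
  assumes \<psi>: "nontrivial_additive_character \<psi>"
    and \<chi>: "\<And>i. i < n \<Longrightarrow> mult_character (\<chi> i)"
    and n: "n \<ge> 2" and a: "a \<noteq> 0"
  shows "bessel_function n \<psi> (generic_constituent n \<psi> \<chi>) (shift_mat n a) =
    (\<Sum>x\<in>{..<n - 1} \<rightarrow>\<^sub>E UNIV. col_term n \<psi> \<chi> a x) / of_nat CARD('a) ^ (n - 1)"
proof -
  interpret whittaker_setup "GL n" "unipotent_grp n" "lower_borel n" "unip_char n \<psi>"
    "diag_char n \<chi>" "whittaker_vec n \<psi> \<chi>"
    by (rule whittaker_setup_GL[OF \<psi> \<chi>])
  let ?X = "{..<n - 1} \<rightarrow>\<^sub>E (UNIV :: 'a set)" and ?U = "unipotent_grp n :: 'a mat set"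
  let ?H = "col_term n \<psi> \<chi> a"
  define F where "F u = ?H (\<lambda>i. u $$ (i, n - 1))" for u
  have shift: "(\<Sum>x\<in>?X. F (last_col_mat n x * u)) = (\<Sum>x\<in>?X. ?H x)" if u: "u \<in> ?U" for u
  proof -
    have uc: "u \<in> carrier_mat n n" "u $$ (n - 1, n - 1) = 1"
      using u n by (auto simp: unipotent_grp_iff)
    \<comment> \<open>The corner entry of \<open>u\<close> is 1, so the column matrix simply adds
      \<open>x\<close> to the last column.\<close>
    let ?s = "\<lambda>x. restrict (\<lambda>i. u $$ (i, n - 1) + x i) {..<n - 1}"
    have "F (last_col_mat n x * u) = ?H (?s x)" for x
      unfolding F_def
      using n uc by (intro col_term_cong) (auto simp: last_col_mat_mult simp del: index_mult_mat(1))
    moreover have "bij_betw ?s ?X ?X"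
    proof (rule bij_betwI[where g = "\<lambda>x. restrict (\<lambda>i. x i - u $$ (i, n - 1)) {..<n - 1}"])
      fix x assume "x \<in> ?X"
      then show "restrict (\<lambda>i. ?s x i - u $$ (i, n - 1)) {..<n - 1} = x"
        "?s (restrict (\<lambda>i. x i - u $$ (i, n - 1)) {..<n - 1}) = x"
        by (auto simp: fun_eq_iff PiE_iff extensional_def restrict_def)
    qed auto
    ultimately show ?thesis using sum.reindex_bij_betw[of ?s ?X ?X ?H] by simp
  qed
  have "of_nat CARD('a) ^ (n - 1) * (\<Sum>u\<in>?U. F u) = (\<Sum>x\<in>?X. \<Sum>u\<in>?U. F u)"
    by (simp add: card_PiE)
  also have "\<dots> = (\<Sum>x\<in>?X. \<Sum>u\<in>?U. F (last_col_mat n x * u))"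
    using sum.reindex_bij_betw[OF bij_left_mult_U[OF last_col_mat_unipotent], of F]
    by (simp add: GL_simps)
  also have "\<dots> = (\<Sum>u\<in>?U. \<Sum>x\<in>?X. F (last_col_mat n x * u))" by (rule sum.swap)
  also have "\<dots> = of_nat (card ?U) * (\<Sum>x\<in>?X. ?H x)" using shift by simp
  finally have "(\<Sum>u\<in>?U. F u) / of_nat (card ?U) = (\<Sum>x\<in>?X. ?H x) / of_nat CARD('a) ^ (n - 1)"
    using card_U by (simp add: field_simps)
  moreover have "bessel_function n \<psi> (generic_constituent n \<psi> \<chi>) (shift_mat n a) =
      (\<Sum>u\<in>?U. F u) / of_nat (card ?U)"
    using bessel_generic_constituent[OF \<psi> \<chi> shift_mat_GL[OF n a]]
      averaged_term_eq_col_term[OF \<psi> \<chi> n a] by (simp add: F_def)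
  ultimately show ?thesis by simp
qed

text \<open>For this column the lower factor has the diagonal of \<open>torus_param\<close> and the
  upper factor contributes the summands \<open>i < n - 1\<close>; the summand
  \<open>i = n - 1\<close> comes from the conjugated character in \<open>col_term\<close>.\<close>

lemma col_term_gt_node:
  fixes \<psi> :: "'a :: {finite, field} \<Rightarrow> complex"
  assumes ac: "additive_character \<psi>"
    and n: "n \<ge> 2" and a: "a \<noteq> 0" and y: "y \<in> {1..n - 1} \<rightarrow>\<^sub>E {x. x \<noteq> 0}"
  shows "col_term n \<psi> \<chi> a (\<lambda>i. y (i + 1) / a) =
    diag_char n \<chi> (torus_param n a y) * \<psi> (- (\<Sum>i<n. gt_node n a y i / gt_node n a y (i + 1)))"
proof -
  let ?z = "gt_node n a y"
  have z: "\<And>k. k \<le> n \<Longrightarrow> ?z k \<noteq> 0" "?z 0 = -1" "?z n = a"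
    using gt_node_nonzero[OF a y] n by (auto simp: gt_node_def)
  define b where "b = mat n n (\<lambda>(i, j). if j \<le> i then - (?z (i + 1) / ?z j) else 0)"
  define v where "v = mat n n (\<lambda>(i, j). if i = j then 1 else if j = i + 1 then - (?z i / ?z j) else 0)"
  note * = last_col_shift_decomposition[OF n z b_def v_def]
  have "last_col_mat n (\<lambda>i. y (i + 1) / a) = last_col_mat n (\<lambda>i. ?z (i + 1) / a)"
    by (rule last_col_mat_cong) (auto simp: gt_node_def)
  then have "whittaker_vec n \<psi> \<chi> (last_col_mat n (\<lambda>i. y (i + 1) / a) * shift_mat n a) =
      diag_char n \<chi> b * unip_char n \<psi> v"
    using * by (simp add: whittaker_vec_big_cell)
  moreover have "diag_char n \<chi> b = diag_char n \<chi> (torus_param n a y)"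
    unfolding diag_char_def torus_param_eq[OF n]
    by (intro prod.cong) (auto simp: b_def mat_diag_def)
  moreover have "unip_char n \<psi> v = \<psi> (- (\<Sum>i<n - 1. ?z i / ?z (i + 1)))"
    unfolding unip_char_def sum_negf[symmetric]
    by (intro arg_cong[of _ _ \<psi>] sum.cong) (auto simp: v_def)
  moreover have "(\<Sum>i<n. ?z i / ?z (i + 1)) = (\<Sum>i<n - 1. ?z i / ?z (i + 1)) + y (n - 1) / a"
  proof -
    obtain m where m: "n = Suc m" using n by (cases n) auto
    show ?thesis using n unfolding m by (simp add: gt_node_def)
  qed
  moreover have "\<psi> (- (s + t)) = \<psi> (- t) * \<psi> (- s)" for s t
    using ac unfolding additive_character_def by (metis minus_add)
  moreover have "n - 2 + 1 = n - 1" using n by simp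
  ultimately show ?thesis
    using cnj_additive_character[OF ac, of "y (n - 1) / a"] by (simp only: col_term_def mult_ac)
qed

lemma bessel_shift_mat:
  fixes \<psi> :: "'a :: {finite, field} \<Rightarrow> complex"
  assumes \<psi>: "nontrivial_additive_character \<psi>"
    and \<chi>: "\<And>i. i < n \<Longrightarrow> mult_character (\<chi> i)"
    and n: "n \<ge> 2" and a: "a \<noteq> 0"
  shows "bessel_function n \<psi> (generic_constituent n \<psi> \<chi>) (shift_mat n a) =
    (\<Sum>y\<in>{1..n - 1} \<rightarrow>\<^sub>E {x. x \<noteq> 0}. diag_char n \<chi> (torus_param n a y) *
      \<psi> (- (\<Sum>i<n. gt_node n a y i / gt_node n a y (i + 1)))) / of_nat CARD('a) ^ (n - 1)"
proof -
  have ac: "additive_character \<psi>" using \<psi> by (simp add: nontrivial_additive_character_def)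
  let ?X = "{..<n - 1} \<rightarrow>\<^sub>E (UNIV :: 'a set)" and ?X' = "{..<n - 1} \<rightarrow>\<^sub>E {x :: 'a. x \<noteq> 0}"
  let ?Y = "{1..n - 1} \<rightarrow>\<^sub>E {x :: 'a. x \<noteq> 0}"
  let ?s = "\<lambda>y. restrict (\<lambda>i. y (i + 1) / a) {..<n - 1}"
  have "(\<Sum>x\<in>?X. col_term n \<psi> \<chi> a x) = (\<Sum>x\<in>?X'. col_term n \<psi> \<chi> a x)"
  proof (rule sum.mono_neutral_right)
    show "\<forall>x\<in>?X - ?X'. col_term n \<psi> \<chi> a x = 0"
    proof
      fix x assume "x \<in> ?X - ?X'"
      then obtain k where "k < n - 1" "x k = 0" by (auto simp: PiE_iff)
      then show "col_term n \<psi> \<chi> a x = 0" by (rule col_term_zero)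
    qed
  qed (auto simp: finite_PiE)
  also have "\<dots> = (\<Sum>y\<in>?Y. col_term n \<psi> \<chi> a (?s y))"
  \<comment> \<open>Rows count from 0 and nodes from 1, hence the index shift; multiplication by
    \<open>a\<close> undoes the division.\<close>
  proof (rule sum.reindex_bij_betw[symmetric], rule bij_betwI[where g = "\<lambda>x. restrict (\<lambda>i. x (i - 1) * a) {1..n - 1}"])
    show "?s \<in> ?Y \<rightarrow> ?X'"
    proof
      fix y assume y: "y \<in> ?Y"
      have "y (i + 1) / a \<noteq> 0" if "i < n - 1" for i
        using PiE_mem[OF y, of "i + 1"] that a by simp
      then show "?s y \<in> ?X'" by (simp add: restrict_PiE_iff)
    qed
    show "(\<lambda>x. restrict (\<lambda>i. x (i - 1) * a) {1..n - 1}) \<in> ?X' \<rightarrow> ?Y"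
    proof
      fix x assume x: "x \<in> ?X'"
      have "x (i - 1) * a \<noteq> 0" if "i \<in> {1..n - 1}" for i
      proof -
        have "i - 1 < n - 1" using that unfolding atLeastAtMost_iff by arith
        then show ?thesis using PiE_mem[OF x, of "i - 1"] a by simp
      qed
      then show "restrict (\<lambda>i. x (i - 1) * a) {1..n - 1} \<in> ?Y" by (simp add: restrict_PiE_iff)
    qed
  next
    fix y assume y: "y \<in> ?Y"
    show "restrict (\<lambda>i. ?s y (i - 1) * a) {1..n - 1} = y"
    proof (rule extensionalityI[OF restrict_extensional])
      show "y \<in> extensional {1..n - 1}" using y by (simp add: PiE_iff)
      fix i assume i: "i \<in> {1..n - 1}"
      then have "i - 1 \<in> {..<n - 1}" "i - 1 + 1 = i" unfolding atLeastAtMost_iff lessThan_iff by arith+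
      then show "restrict (\<lambda>i. ?s y (i - 1) * a) {1..n - 1} i = y i"
        using i a by (simp only: restrict_apply') simp
    qed
  next
    fix x assume x: "x \<in> ?X'"
    show "?s (restrict (\<lambda>i. x (i - 1) * a) {1..n - 1}) = x"
    proof (rule extensionalityI[OF restrict_extensional])
      show "x \<in> extensional {..<n - 1}" using x by (simp add: PiE_iff)
      fix i assume i: "i \<in> {..<n - 1}"
      then have "i + 1 \<in> {1..n - 1}" by auto
      then show "?s (restrict (\<lambda>i. x (i - 1) * a) {1..n - 1}) i = x i"
        using i a by (simp only: restrict_apply') simp
    qed
  qed
  also have "\<dots> = (\<Sum>y\<in>?Y. diag_char n \<chi> (torus_param n a y) *
      \<psi> (- (\<Sum>i<n. gt_node n a y i / gt_node n a y (i + 1))))"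
  proof (rule sum.cong[OF refl])
    fix y assume "y \<in> ?Y"
    moreover have "col_term n \<psi> \<chi> a (?s y) = col_term n \<psi> \<chi> a (\<lambda>i. y (i + 1) / a)"
      by (rule col_term_cong[OF n]) simp
    ultimately show "col_term n \<psi> \<chi> a (?s y) = diag_char n \<chi> (torus_param n a y) *
      \<psi> (- (\<Sum>i<n. gt_node n a y i / gt_node n a y (i + 1)))"
      using col_term_gt_node[OF ac n a] by simp
  qed
  finally show ?thesis using bessel_shift_mat_col_sum[OF \<psi> \<chi> n a] by simp
qed

subsection \<open>Fourier inversion on the torus\<close>

text \<open>Cyclicity of the multiplicative group is available for ring records, so the type is
  packaged as a record with full carrier and its powers are translated back.\<close>

lemma finite_field_generator:
  "\<exists>g :: 'a :: {finite, field}. g \<noteq> 0 \<and> (\<forall>x. x \<noteq> 0 \<longrightarrow> (\<exists>k :: nat. x = g ^ k))"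
proof -
  let ?R = "\<lparr>carrier = UNIV, mult = (*), one = 1, zero = 0, add = (+)\<rparr> :: 'a ring"
  have inv: "x \<noteq> 0 \<Longrightarrow> \<exists>y. x * y = 1" for x :: 'a
    by (rule exI[of _ "inverse x"]) simp
  have "cring ?R"
    by (intro cringI abelian_groupI comm_monoidI) (auto simp: algebra_simps intro: exI[of _ "- _"])
  then interpret field ?R
    using inv by (intro cring.cring_fieldI2) auto
  have pow: "x [^]\<^bsub>?R\<^esub> k = x ^ k" for x :: 'a and k :: nat
    by (induction k) (auto simp: nat_pow_def mult.commute)
  show ?thesis
    using finite_field_mult_group_has_gen by (auto simp: pow set_eq_iff)
qed

text \<open>The discrete logarithm to a generator of the multiplicative group, exponentiated.\<close>

lemma faithful_mult_character:
  "\<exists>\<chi> :: 'a :: {finite, field} \<Rightarrow> complex. mult_character \<chi> \<and> inj_on \<chi> {x. x \<noteq> 0} \<and>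
    (\<forall>x. x \<noteq> 0 \<longrightarrow> \<chi> x ^ (CARD('a) - 1) = 1)"
proof -
  define N where "N = CARD('a) - 1"
  let ?X = "{x :: 'a. x \<noteq> 0}"
  have cX: "card ?X = N"
  proof -
    have "?X = UNIV - {0}" by auto
    then show ?thesis by (simp add: N_def card_Diff_singleton)
  qed
  have "(1 :: 'a) \<in> ?X" by simp
  then have "?X \<noteq> {}" by blast
  then have Npos: "N > 0" using cX card_gt_0_iff[of ?X] finite[of ?X] by auto
  obtain g :: 'a where g0: "g \<noteq> 0" and g: "\<And>x. x \<noteq> 0 \<Longrightarrow> \<exists>k :: nat. x = g ^ k"
    using finite_field_generator by blast
  have gN: "g ^ N = 1"
  proof -
    \<comment> \<open>Multiplication by \<open>g\<close> permutes the nonzero elements; comparing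
      products gives Fermat's identity.\<close>
    have "bij_betw (\<lambda>y. g * y) ?X ?X"
      by (rule bij_betwI[where g = "\<lambda>y. y / g"]) (use g0 in auto)
    then have "(\<Prod>y\<in>?X. g * y) = \<Prod>?X"
      by (rule prod.reindex_bij_betw)
    then have "g ^ N * \<Prod>?X = 1 * \<Prod>?X"
      unfolding prod.distrib prod_constant cX by simp
    moreover have "\<Prod>?X \<noteq> 0" by simp
    ultimately show ?thesis using mult_right_cancel by blast
  qed
  have gmod: "g ^ k = g ^ (k mod N)" for k
  proof -
    have "g ^ (N * (k div N) + k mod N) = (g ^ N) ^ (k div N) * g ^ (k mod N)"
      by (simp only: power_add power_mult)
    then show ?thesis by (simp add: gN)
  qed
  have img: "(\<lambda>k. g ^ k) ` {..<N} = ?X"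
  proof
    show "?X \<subseteq> (\<lambda>k. g ^ k) ` {..<N}"
    proof
      fix x assume "x \<in> ?X"
      then obtain k where "x = g ^ k" using g by blast
      then have "x = g ^ (k mod N)" using gmod[of k] by (rule trans)
      moreover have "k mod N \<in> {..<N}" using Npos by simp
      ultimately show "x \<in> (\<lambda>k. g ^ k) ` {..<N}" by (rule image_eqI)
    qed
  qed (use g0 in auto)
  \<comment> \<open>\<open>N\<close> exponents map onto \<open>N\<close> elements, so logarithms
    below \<open>N\<close> are unique.\<close>
  have inj: "inj_on (\<lambda>k. g ^ k) {..<N}"
    by (rule eq_card_imp_inj_on) (simp_all only: img cX finite_lessThan card_lessThan)
  define L where "L = inv_into {..<N} (\<lambda>k. g ^ k)"
  have L: "L x < N" "g ^ L x = x" if "x \<noteq> 0" for x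
  proof -
    have x: "x \<in> (\<lambda>k. g ^ k) ` {..<N}" unfolding img using that by simp
    show "L x < N" using inv_into_into[OF x] by (simp add: L_def)
    show "g ^ L x = x" using f_inv_into_f[OF x] by (simp add: L_def)
  qed
  have L_mult: "L (x * y) = (L x + L y) mod N" if "x \<noteq> 0" "y \<noteq> 0" for x y
  proof (rule inj_onD[OF inj])
    have "g ^ L (x * y) = g ^ (L x + L y)"
      using L that by (simp add: power_add)
    also have "\<dots> = g ^ ((L x + L y) mod N)" by (rule gmod)
    finally show "g ^ L (x * y) = g ^ ((L x + L y) mod N)" .
    show "L (x * y) \<in> {..<N}" "(L x + L y) mod N \<in> {..<N}"
      using L(1)[of "x * y"] that Npos by simp_all
  qed
  define e where "e k = cis (2 * pi * real k / real N)" for k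
  have e_add: "e (k + l) = e k * e l" for k l
    by (simp add: e_def cis_mult add_divide_distrib distrib_left)
  have eN: "e k ^ N = 1" for k
  proof -
    have "e k ^ N = cis (2 * pi * real k)"
      using Npos unfolding e_def DeMoivre by simp
    then show ?thesis by simp
  qed
  have e_mod: "e (k mod N) = e k" for k
  proof -
    have "e (N * m) = 1" for m
    proof -
      have "2 * pi * real (N * m) / real N = 2 * pi * real m" using Npos by simp
      then have "e (N * m) = cis (2 * pi * real m)" by (simp only: e_def)
      then show ?thesis by simp
    qed
    then have "e (N * (k div N) + k mod N) = e (k mod N)" unfolding e_add by simp
    then show ?thesis by simp
  qed
  have e_inj: "inj_on e {..<N}"
    using bij_betw_roots_unity[OF Npos] by (simp add: bij_betw_def e_def[abs_def])
  show ?thesis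
  proof (intro exI[of _ "\<lambda>x. e (L x)"] conjI allI impI)
    show "mult_character (\<lambda>x. e (L x))"
    proof -
      have "e k \<noteq> 0" for k by (simp add: e_def)
      then show ?thesis by (simp add: mult_character_def e_mod e_add L_mult)
    qed
    show "inj_on (\<lambda>x. e (L x)) ?X"
    proof (rule inj_onI)
      fix x y assume xy: "x \<in> ?X" "y \<in> ?X" "e (L x) = e (L y)"
      then have "L x = L y" using L(1)[of x] L(1)[of y] by (intro inj_onD[OF e_inj]) auto
      then have "g ^ L x = g ^ L y" by (rule arg_cong)
      moreover have "g ^ L x = x" "g ^ L y = y" using xy by (auto intro: L(2))
      ultimately show "x = y" by metis
    qed
    show "e (L x) ^ (CARD('a) - 1) = 1" for x using eN unfolding N_def .
  qed
qed

text \<open>Powers of a faithful character are orthogonal: the sum is geometric, and its ratio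
  \<open>\<chi> x / \<chi> x\<^sub>0\<close> is a root of unity of order dividing q - 1 that equals
  1 only at \<open>x\<^sub>0\<close>.\<close>

lemma delta_mult_characters:
  fixes x\<^sub>0 :: "'a :: {finite, field}"
  assumes "x\<^sub>0 \<noteq> 0"
  shows "\<exists>c C. (\<forall>k. mult_character (C k)) \<and>
    (\<forall>x. x \<noteq> 0 \<longrightarrow> (\<Sum>k<CARD('a) - 1. c k * C k x) = (if x = x\<^sub>0 then 1 else 0 :: complex))"
proof -
  let ?N = "CARD('a) - 1"
  obtain \<chi> :: "'a \<Rightarrow> complex" where \<chi>: "mult_character \<chi>" "inj_on \<chi> {x. x \<noteq> 0}"
    "\<And>x. x \<noteq> 0 \<Longrightarrow> \<chi> x ^ ?N = 1"
    using faithful_mult_character by blast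
  have nz: "\<chi> x \<noteq> 0" if "x \<noteq> 0" for x using \<chi>(1) that by (simp add: mult_character_def)
  have "card {0, 1 :: 'a} \<le> CARD('a)" by (rule card_mono) auto
  then have N: "?N > 0" by simp
  define C where "C k x = \<chi> x ^ k" for k x
  \<comment> \<open>The values of \<open>\<chi>\<close> being roots of unity, these are the
    conjugates of \<open>\<chi> x\<^sub>0 ^ k\<close> over q - 1: the Fourier coefficients of a
    point mass.\<close>
  define c where "c k = 1 / (of_nat ?N * \<chi> x\<^sub>0 ^ k)" for k
  have "mult_character (C k)" for k
    using \<chi>(1) by (auto simp: mult_character_def C_def power_mult_distrib)
  moreover have "(\<Sum>k<?N. c k * C k x) = (if x = x\<^sub>0 then 1 else 0)" if x: "x \<noteq> 0" for x
  proof -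
    define z where "z = \<chi> x / \<chi> x\<^sub>0"
    have "c k * C k x = z ^ k / of_nat ?N" for k
      by (simp only: c_def C_def z_def power_divide) simp
    then have eq: "(\<Sum>k<?N. c k * C k x) = (\<Sum>k<?N. z ^ k) / of_nat ?N"
      by (simp only: sum_divide_distrib)
    show ?thesis
    proof (cases "x = x\<^sub>0")
      case True
      then have "z = 1" using nz x by (simp add: z_def)
      then show ?thesis using True N unfolding eq by simp
    next
      case False
      then have "z \<noteq> 1"
        using inj_onD[OF \<chi>(2), of x x\<^sub>0] x assms nz[OF assms] by (auto simp: z_def)
      moreover have "z ^ ?N = 1" using \<chi>(3) x assms by (simp add: z_def power_divide)
      ultimately have "(\<Sum>k<?N. z ^ k) = 0" using geometric_sum[of z ?N] by simp
      then show ?thesis using False unfolding eq by simp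
    qed
  qed
  ultimately show ?thesis by blast
qed

lemma diag_torus_iff:
  "t \<in> diag_torus n \<longleftrightarrow> t \<in> carrier_mat n n \<and> diagonal_mat t \<and> (\<forall>i<n. t $$ (i, i) \<noteq> 0)"
  and det_diag_torus: "t \<in> diag_torus n \<Longrightarrow> det t = (\<Prod>i<n. t $$ (i, i))"
proof -
  have "det t = (\<Prod>i<n. t $$ (i, i))" if "t \<in> carrier_mat n n" "diagonal_mat t"
    using that det_upper_triangular[of t n]
    by (auto simp: diagonal_mat_def upper_triangular_def prod_list_diag_prod atLeast0LessThan)
  then show "t \<in> diag_torus n \<longleftrightarrow> t \<in> carrier_mat n n \<and> diagonal_mat t \<and> (\<forall>i<n. t $$ (i, i) \<noteq> 0)"
    "t \<in> diag_torus n \<Longrightarrow> det t = (\<Prod>i<n. t $$ (i, i))"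
    by (auto simp: diag_torus_def carrier_GL_iff)
qed

lemma diag_torus_eqI:
  assumes "s \<in> diag_torus n" "t \<in> diag_torus n" "\<And>i. i < n \<Longrightarrow> s $$ (i, i) = t $$ (i, i)"
  shows "s = t"
proof (rule eq_matI)
  fix i j assume "i < dim_row t" "j < dim_col t"
  then show "s $$ (i, j) = t $$ (i, j)"
    using assms by (cases "i = j") (auto simp: diag_torus_iff diagonal_mat_def)
qed (use assms in \<open>auto simp: diag_torus_iff\<close>)

text \<open>The point mass at \<open>t\<^sub>0\<close> is a product of one-variable point masses
  along the diagonal. Expanding each in characters and multiplying out writes it as a combination of
  characters of the torus, against all of which \<open>D\<close> sums to 0.\<close>

lemma torus_function_zero:
  fixes D :: "'a :: {finite, field} mat \<Rightarrow> complex"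
  assumes D: "\<And>\<chi>. (\<And>i. i < n \<Longrightarrow> mult_character (\<chi> i)) \<Longrightarrow> (\<Sum>t\<in>diag_torus n. D t * diag_char n \<chi> t) = 0"
    and t0: "t\<^sub>0 \<in> diag_torus n"
  shows "D t\<^sub>0 = 0"
proof -
  let ?N = "CARD('a) - 1" and ?T = "diag_torus n :: 'a mat set"
  have fin: "finite ?T" by (rule finite_subset[OF _ finite_GL]) (auto simp: diag_torus_def)
  have "\<forall>i\<in>{..<n}. \<exists>c C. (\<forall>k. mult_character (C k)) \<and>
    (\<forall>x. x \<noteq> 0 \<longrightarrow> (\<Sum>k<?N. c k * C k x) = (if x = t\<^sub>0 $$ (i, i) then 1 else 0 :: complex))"
    using t0 by (intro ballI delta_mult_characters) (auto simp: diag_torus_iff)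
  from bchoice[OF this] obtain c where "\<forall>i\<in>{..<n}. \<exists>C. (\<forall>k. mult_character (C k)) \<and>
    (\<forall>x. x \<noteq> 0 \<longrightarrow> (\<Sum>k<?N. c i k * C k x) = (if x = t\<^sub>0 $$ (i, i) then 1 else 0 :: complex))" ..
  from bchoice[OF this] obtain C where cC': "\<forall>i\<in>{..<n}. (\<forall>k. mult_character (C i k)) \<and>
    (\<forall>x. x \<noteq> 0 \<longrightarrow> (\<Sum>k<?N. c i k * C i k x) = (if x = t\<^sub>0 $$ (i, i) then 1 else 0 :: complex))" ..
  then have C: "\<And>i k. i < n \<Longrightarrow> mult_character (C i k)" by blast
  have cC: "(\<Sum>k<?N. c i k * C i k x) = (if x = t\<^sub>0 $$ (i, i) then 1 else 0 :: complex)"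
    if "i < n" "x \<noteq> 0" for i x
    using cC' that by blast
  let ?K = "{..<n} \<rightarrow>\<^sub>E {..<?N}"
  \<comment> \<open>\<open>\<kappa>\<close> selects one character for every diagonal
    position.\<close>
  have "0 = (\<Sum>\<kappa>\<in>?K. (\<Prod>i<n. c i (\<kappa> i)) * (\<Sum>t\<in>?T. D t * diag_char n (\<lambda>i. C i (\<kappa> i)) t))"
    using C by (subst D) simp_all
  also have "\<dots> = (\<Sum>\<kappa>\<in>?K. \<Sum>t\<in>?T. D t * (\<Prod>i<n. c i (\<kappa> i) * C i (\<kappa> i) (t $$ (i, i))))"
    by (simp add: sum_distrib_left diag_char_def prod.distrib mult_ac)
  also have "\<dots> = (\<Sum>t\<in>?T. \<Sum>\<kappa>\<in>?K. D t * (\<Prod>i<n. c i (\<kappa> i) * C i (\<kappa> i) (t $$ (i, i))))"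
    by (rule sum.swap)
  \<comment> \<open>Distributivity read backwards: a sum over tuples of products is a product of
    one-variable sums.\<close>
  also have "\<dots> = (\<Sum>t\<in>?T. D t * (\<Prod>i<n. \<Sum>k<?N. c i k * C i k (t $$ (i, i))))"
    by (simp add: prod_sum_PiE sum_distrib_left)
  also have "\<dots> = (\<Sum>t\<in>?T. if t = t\<^sub>0 then D t\<^sub>0 else 0)"
  proof (rule sum.cong[OF refl])
    fix t assume t: "t \<in> ?T"
    have "(\<Prod>i<n. \<Sum>k<?N. c i k * C i k (t $$ (i, i))) =
        (\<Prod>i<n. if t $$ (i, i) = t\<^sub>0 $$ (i, i) then 1 else 0)"
      using t by (intro prod.cong refl cC) (auto simp: diag_torus_iff)
    also have "\<dots> = (if t = t\<^sub>0 then 1 else 0)"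
    proof (cases "t = t\<^sub>0")
      case False
      then obtain i where "i < n" "t $$ (i, i) \<noteq> t\<^sub>0 $$ (i, i)"
        using diag_torus_eqI[OF t t0] by blast
      then show ?thesis using False by auto
    qed simp
    finally show "D t * (\<Prod>i<n. \<Sum>k<?N. c i k * C i k (t $$ (i, i))) = (if t = t\<^sub>0 then D t\<^sub>0 else 0)"
      by simp
  qed
  finally show ?thesis using fin t0 by simp
qed

section \<open>Trace of the inverse, and torus elements of fixed determinant\<close>

lemma mat_trace_inv_diag_torus:
  fixes t :: "'a :: {finite, field} mat"
  assumes t: "t \<in> diag_torus n"
  shows "mat_trace (inv\<^bsub>GL n\<^esub> t) = (\<Sum>i<n. 1 / t $$ (i, i))"
proof -
  interpret group "GL n :: 'a mat monoid" by (rule group_GL)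
  let ?s = "mat_diag n (\<lambda>i. 1 / t $$ (i, i))"
  have s: "?s \<in> diag_torus n"
    using t by (auto simp: diag_torus_iff diagonal_mat_def mat_diag_def)
  have tc: "t \<in> carrier_mat n n" using t by (simp add: diag_torus_iff)
  have "?s * t = 1\<^sub>m n"
    unfolding mat_diag_mult_left[OF tc]
    by (rule eq_matI) (use t in \<open>auto simp: diag_torus_iff diagonal_mat_def\<close>)
  then have "inv\<^bsub>GL n\<^esub> t = ?s"
    using s t by (intro inv_equality) (auto simp: GL_simps diag_torus_def)
  then show ?thesis by (simp add: mat_trace_def mat_diag_def)
qed

lemma torus_param_diag_torus:
  assumes "n \<ge> 2" "a \<noteq> 0" "y \<in> {1..n - 1} \<rightarrow>\<^sub>E {x. x \<noteq> 0}"
  shows "torus_param n a y \<in> diag_torus n"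
    and "i < n \<Longrightarrow> torus_param n a y $$ (i, i) = - (gt_node n a y (i + 1) / gt_node n a y i)"
  using assms gt_node_nonzero[OF assms(2,3)]
  by (auto simp: diag_torus_iff diagonal_mat_def torus_param_eq mat_diag_def)

text \<open>For \<open>torus_param\<close> the entry \<open>- t $$ (i, i)\<close> is the ratio of
  consecutive nodes, so the product telescopes to node \<open>k\<close> over node 0, which is -1.
  This recovers the nodes from the matrix.\<close>

definition torus_node :: "'a :: field mat \<Rightarrow> nat \<Rightarrow> 'a" where
  "torus_node t k = - (\<Prod>i<k. - t $$ (i, i))"

lemma torus_node_Suc: "torus_node t (Suc k) = - (t $$ (k, k) * torus_node t k)"
  by (simp add: torus_node_def mult.commute)

text \<open>There are \<open>n\<close> minus signs from the diagonal factors and one from the start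
  at -1; \<open>n + 1\<close> has the parity of \<open>n - 1\<close>.\<close>

lemma torus_node_det:
  assumes "t \<in> diag_torus n" "n > 0"
  shows "det t = (- 1) ^ (n - 1) * torus_node t n"
proof -
  obtain m where m: "n = Suc m" using assms(2) by (cases n) auto
  have "(- 1) ^ m * ((- 1) ^ m * x) = x" for x :: 'a
    by (simp flip: power_mult_distrib mult.assoc)
  then show ?thesis
    using det_diag_torus[OF assms(1)] unfolding m torus_node_def prod_uminus by simp
qed

lemma torus_node_torus_param:
  assumes "n \<ge> 2" "a \<noteq> 0" "y \<in> {1..n - 1} \<rightarrow>\<^sub>E {x. x \<noteq> 0}"
  shows "k \<le> n \<Longrightarrow> torus_node (torus_param n a y) k = gt_node n a y k"
proof (induction k)
  case 0
  then show ?case using assms(1) by (simp add: torus_node_def gt_node_def)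
next
  case (Suc k)
  then show ?case
    using torus_param_diag_torus(2)[OF assms, of k] gt_node_nonzero[OF assms(2,3), of k]
    by (simp add: torus_node_Suc)
qed

text \<open>The inverse reads off the nodes. Nodes 1 to \<open>n - 1\<close> are free, and the
  determinant condition says exactly that the last node is \<open>a\<close>.\<close>

lemma bij_betw_torus_param:
  fixes a :: "'a :: field"
  assumes n: "n \<ge> 2" and a: "a \<noteq> 0"
  shows "bij_betw (torus_param n a) ({1..n - 1} \<rightarrow>\<^sub>E {x. x \<noteq> 0})
    {t \<in> diag_torus n. det t = (- 1) ^ (n - 1) * a}"
proof (rule bij_betwI[where g = "\<lambda>t. restrict (torus_node t) {1..n - 1}"])
  let ?Y = "{1..n - 1} \<rightarrow>\<^sub>E {x :: 'a. x \<noteq> 0}" and ?T = "{t \<in> diag_torus n. det t = (- 1) ^ (n - 1) * a}"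
  show "torus_param n a \<in> ?Y \<rightarrow> ?T"
  proof
    fix y assume y: "y \<in> ?Y"
    have "torus_node (torus_param n a y) n = a"
      using torus_node_torus_param[OF n a y, of n] n by (simp add: gt_node_def)
    then show "torus_param n a y \<in> ?T"
      using torus_param_diag_torus(1)[OF n a y] n by (simp add: torus_node_det)
  qed
  have nz: "torus_node t k \<noteq> 0" if "t \<in> ?T" "k \<le> n" for t k
    using that by (auto simp: torus_node_def diag_torus_iff)
  show in_Y: "(\<lambda>t. restrict (torus_node t) {1..n - 1}) \<in> ?T \<rightarrow> ?Y"
  proof
    fix t assume "t \<in> ?T"
    then show "restrict (torus_node t) {1..n - 1} \<in> ?Y"
      using nz by (auto simp: restrict_PiE_iff)
  qed
  show "restrict (torus_node (torus_param n a y)) {1..n - 1} = y" if y: "y \<in> ?Y" for y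
  proof (rule extensionalityI[OF restrict_extensional])
    show "y \<in> extensional {1..n - 1}" using y by (simp add: PiE_iff)
    fix k assume k: "k \<in> {1..n - 1}"
    then have "k \<le> n" "k \<noteq> 0" "k \<noteq> n" using n by auto
    then show "restrict (torus_node (torus_param n a y)) {1..n - 1} k = y k"
      using torus_node_torus_param[OF n a y] k by (simp add: gt_node_def)
  qed
  show "torus_param n a (restrict (torus_node t) {1..n - 1}) = t" if t: "t \<in> ?T" for t
  proof -
    let ?y = "restrict (torus_node t) {1..n - 1}"
    have y: "?y \<in> ?Y" using in_Y t by blast
    have "(- 1) ^ (n - 1) * torus_node t n = (- 1) ^ (n - 1) * a"
      using torus_node_det[of t n] t n by simp
    then have tn: "torus_node t n = a" by simp
    have node: "gt_node n a ?y k = torus_node t k" if "k \<le> n" for k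
    proof -
      have "k \<in> {1..n - 1}" if "k \<noteq> 0" "k \<noteq> n"
        using that \<open>k \<le> n\<close> unfolding atLeastAtMost_iff by arith
      then show ?thesis
        using tn by (auto simp: gt_node_def torus_node_def)
    qed
    show ?thesis
    proof (rule diag_torus_eqI[OF torus_param_diag_torus(1)[OF n a y]])
      show "t \<in> diag_torus n" using t by simp
      fix i assume i: "i < n"
      then have le: "i \<le> n" "i + 1 \<le> n" by simp_all
      show "torus_param n a ?y $$ (i, i) = t $$ (i, i)"
        unfolding torus_param_diag_torus(2)[OF n a y i] node[OF le(1)] node[OF le(2)]
        using nz[OF t le(1)] by (simp add: torus_node_Suc)
    qed
  qed
qed

lemma mat_trace_inv_torus_param:
  fixes a :: "'a :: {finite, field}"
  assumes "n \<ge> 2" "a \<noteq> 0" "y \<in> {1..n - 1} \<rightarrow>\<^sub>E {x. x \<noteq> 0}"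
  shows "mat_trace (inv\<^bsub>GL n\<^esub> (torus_param n a y)) =
    - (\<Sum>i<n. gt_node n a y i / gt_node n a y (i + 1))"
  unfolding mat_trace_inv_diag_torus[OF torus_param_diag_torus(1)[OF assms]] sum_negf[symmetric]
  by (rule sum.cong) (auto simp: torus_param_diag_torus(2)[OF assms])

section \<open>The arrow sum of the Gelfand-Tsetlin diagram\<close>

lemma gt_node_sum:
  assumes n: "n \<ge> 2"
  shows "- (\<Sum>i<n. gt_node n a y i / gt_node n a y (i + 1)) =
    1 / y 1 - (\<Sum>j = 2..n - 1. y (j - 1) / y j) - y (n - 1) / a"
proof -
  obtain m where m: "n = Suc (Suc m)" using n by (metis add_2_eq_Suc le_Suc_ex)
  have "(\<Sum>i<n. gt_node n a y i / gt_node n a y (i + 1)) =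
      gt_node n a y 0 / gt_node n a y 1 +
      (\<Sum>i<m. gt_node n a y (Suc i) / gt_node n a y (Suc (Suc i))) +
      gt_node n a y (n - 1) / gt_node n a y n"
    unfolding m by (subst sum.lessThan_Suc) (simp only: sum.lessThan_Suc_shift, simp)
  also have "(\<Sum>i<m. gt_node n a y (Suc i) / gt_node n a y (Suc (Suc i))) =
      (\<Sum>i<m. y (Suc i) / y (Suc (Suc i)))"
    by (intro sum.cong) (auto simp: gt_node_def m)
  also have "\<dots> = (\<Sum>j = 2..n - 1. y (j - 1) / y j)"
    \<comment> \<open>\<open>j\<close> names the target of an arrow between inner nodes, so it
      starts at 2 while \<open>i\<close> starts at 0.\<close>
    by (rule sum.reindex_bij_witness[of _ "\<lambda>j. j - 2" "\<lambda>i. i + 2"]) (auto simp: m)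
  finally show ?thesis by (simp add: gt_node_def m)
qed

text \<open>A vertical arrow from 1 weighs as much as a horizontal arrow from -1, so the diagram
  becomes a uniform chain of horizontal arrows through the nodes.\<close>

lemma gt_diagram_sum:
  assumes n: "n \<ge> 2"
  shows "sum_list (map arrow_weight (gt_diagram n a y)) =
    - (\<Sum>i<n. gt_node n a y i / gt_node n a y (i + 1))"
proof -
  let ?z = "gt_node n a y"
  have nodes: "map y [1..<n] @ [a] = map ?z [1..<n + 1]"
    using n by (auto simp: gt_node_def)
  have "tl (map ?z [1..<n + 1]) = map (\<lambda>i. ?z (i + 1)) [1..<n]"
    using n by (simp add: map_tl[symmetric] tl_upt map_Suc_upt[symmetric] comp_def del: map_Suc_upt upt_Suc)
  then have "map arrow_weight (map2 Horizontal (map ?z [1..<n + 1]) (tl (map ?z [1..<n + 1]))) =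
      map (\<lambda>i. - (?z i / ?z (i + 1))) [1..<n]"
    by (intro nth_equalityI) (auto simp del: upt_Suc)
  then have "sum_list (map arrow_weight (gt_diagram n a y)) =
      1 / y 1 + (\<Sum>i = 1..<n. - (?z i / ?z (i + 1)))"
    unfolding gt_diagram_def Let_def nodes by (simp add: interv_sum_list_conv_sum_set_nat del: upt_Suc)
  also have "1 / y 1 = - (?z 0 / ?z 1)" using n by (simp add: gt_node_def)
  also have "- (?z 0 / ?z 1) + (\<Sum>i = 1..<n. - (?z i / ?z (i + 1))) = (\<Sum>i = 0..<n. - (?z i / ?z (i + 1)))"
    using n by (subst sum.atLeast_Suc_lessThan[of 0 n]) auto
  finally show ?thesis by (simp add: sum_negf atLeast0LessThan)
qed

theorem theorem2p1:
  fixes n :: nat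
    and a :: "'a :: {finite, field}"
    and \<psi> :: "'a \<Rightarrow> complex"
    and F :: "('a mat \<Rightarrow> complex) \<Rightarrow> 'a mat \<Rightarrow> complex"
  assumes "odd CARD('a)"
    and "nontrivial_additive_character \<psi>"
    and "n \<ge> 2"
    and "a \<noteq> 0"
    and "curtis_homomorphism n \<psi> F"
  shows "(\<forall>t\<in>diag_torus n.
            F (e_sandwich n \<psi> (delta (anti_block [(n - 1, 1), (1, a)]))) t =
              (if det t = (- 1) ^ (n - 1) * a
               then 1 / of_nat CARD('a) ^ (n - 1) * \<psi> (mat_trace (inv\<^bsub>GL n\<^esub> t))
               else 0)) \<and>
         bij_betw (torus_param n a) ({1..n - 1} \<rightarrow>\<^sub>E {x. x \<noteq> 0})
           {t \<in> diag_torus n. det t = (- 1) ^ (n - 1) * a} \<and>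
         (\<forall>y \<in> {1..n - 1} \<rightarrow>\<^sub>E {x. x \<noteq> 0}.
            \<psi> (mat_trace (inv\<^bsub>GL n\<^esub> (torus_param n a y))) =
              \<psi> (1 / y 1 - (\<Sum>j = 2..n - 1. y (j - 1) / y j) - y (n - 1) / a) \<and>
            1 / y 1 - (\<Sum>j = 2..n - 1. y (j - 1) / y j) - y (n - 1) / a =
              sum_list (map arrow_weight (gt_diagram n a y)))"
proof (intro conjI ballI)
  note n = \<open>n \<ge> 2\<close> and a = \<open>a \<noteq> 0\<close> and \<psi> = \<open>nontrivial_additive_character \<psi>\<close>
  show bij: "bij_betw (torus_param n a) ({1..n - 1} \<rightarrow>\<^sub>E {x. x \<noteq> 0})
      {t \<in> diag_torus n. det t = (- 1) ^ (n - 1) * a}"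
    by (rule bij_betw_torus_param[OF n a])
  let ?T = "diag_torus n :: 'a mat set" and ?Y = "{1..n - 1} \<rightarrow>\<^sub>E {x :: 'a. x \<noteq> 0}"
  let ?bs = "[(n - 1, 1), (1, a)]" and ?q = "of_nat CARD('a) ^ (n - 1) :: complex"
  let ?F = "F (e_sandwich n \<psi> (delta (anti_block ?bs)))"
  define R where "R t = (if det t = (- 1) ^ (n - 1) * a
    then 1 / ?q * \<psi> (mat_trace (inv\<^bsub>GL n\<^esub> t)) else 0)" for t
  fix t assume t: "t \<in> ?T"
  have finT: "finite ?T" by (rule finite_subset[OF _ finite_GL]) (auto simp: diag_torus_def)
  have "?F t - R t = 0"
  proof (rule torus_function_zero[OF _ t])
    fix \<chi> :: "nat \<Rightarrow> 'a \<Rightarrow> complex" assume \<chi>: "\<And>i. i < n \<Longrightarrow> mult_character (\<chi> i)"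
    \<comment> \<open>Here \<open>n \<ge> 2\<close> keeps the first block nonempty.\<close>
    have "composition_data n ?bs" using n a by (simp add: composition_data_def)
    then have "char_extension n \<chi> ?F = bessel_function n \<psi> (generic_constituent n \<psi> \<chi>) (anti_block ?bs)"
      using \<open>curtis_homomorphism n \<psi> F\<close> \<chi> unfolding curtis_homomorphism_def curtis_character_def by blast
    also have "\<dots> = (\<Sum>y\<in>?Y. diag_char n \<chi> (torus_param n a y) *
        \<psi> (- (\<Sum>i<n. gt_node n a y i / gt_node n a y (i + 1)))) / ?q"
      unfolding anti_block_eq_shift_mat[OF n] by (rule bessel_shift_mat[OF \<psi> \<chi> n a])
    also have "\<dots> = (\<Sum>y\<in>?Y. diag_char n \<chi> (torus_param n a y) *
        \<psi> (mat_trace (inv\<^bsub>GL n\<^esub> (torus_param n a y)))) / ?q"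
      using mat_trace_inv_torus_param[OF n a] by simp
    also have "\<dots> = (\<Sum>t\<in>{t \<in> ?T. det t = (- 1) ^ (n - 1) * a}.
        diag_char n \<chi> t * \<psi> (mat_trace (inv\<^bsub>GL n\<^esub> t))) / ?q"
      using sum.reindex_bij_betw[OF bij, of "\<lambda>t. diag_char n \<chi> t * \<psi> (mat_trace (inv\<^bsub>GL n\<^esub> t))"]
      by simp
    also have "\<dots> = (\<Sum>t\<in>{t \<in> ?T. det t = (- 1) ^ (n - 1) * a}. R t * diag_char n \<chi> t)"
      unfolding sum_divide_distrib by (intro sum.cong) (auto simp: R_def)
    \<comment> \<open>\<open>R\<close> vanishes where the determinant condition fails, so the sum
      extends to the whole torus and is the Fourier transform of \<open>R\<close>.\<close>
    also have "\<dots> = (\<Sum>t\<in>?T. R t * diag_char n \<chi> t)"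
      by (rule sum.mono_neutral_left) (auto simp: finT R_def)
    finally show "(\<Sum>t\<in>?T. (?F t - R t) * diag_char n \<chi> t) = 0"
      by (simp add: char_extension_def left_diff_distrib sum_subtractf)
  qed
  then show "?F t = (if det t = (- 1) ^ (n - 1) * a
      then 1 / ?q * \<psi> (mat_trace (inv\<^bsub>GL n\<^esub> t)) else 0)"
    by (simp add: R_def)
next
  fix y :: "nat \<Rightarrow> 'a" assume y: "y \<in> {1..n - 1} \<rightarrow>\<^sub>E {x. x \<noteq> 0}"
  show "\<psi> (mat_trace (inv\<^bsub>GL n\<^esub> (torus_param n a y))) =
      \<psi> (1 / y 1 - (\<Sum>j = 2..n - 1. y (j - 1) / y j) - y (n - 1) / a)"
    unfolding mat_trace_inv_torus_param[OF assms(3,4) y] gt_node_sum[OF assms(3)] ..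
  show "1 / y 1 - (\<Sum>j = 2..n - 1. y (j - 1) / y j) - y (n - 1) / a =
      sum_list (map arrow_weight (gt_diagram n a y))"
    unfolding gt_diagram_sum[OF assms(3)] gt_node_sum[OF assms(3)] ..
qed

end
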